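(* Let $d\ge 1$, let $s\in\{+1,-1\}$, and let $P:\mathbb{R}^d\to\mathbb{R}$ be a measurable function, not identically zero on $\mathbb{R}^d\setminus\{0\}$, such that $P\in L^1_{\rm loc}(\mathbb{R}^d)$, such that $P(-x)=(-1)^{\mathfrak{r}}P(x)$ for all $x\in\mathbb{R}^d$ with some $\mathfrak{r}\in\{0,1\}$, and such that $P\,e^{-\lambda\pi|\cdot|^2}\in L^1(\mathbb{R}^d)$ for all $\lambda>0$. Assume that $P=H\cdot Q$, where $H:\mathbb{R}^d\to\mathbb{R}$ is a homogeneous and harmonic polynomial of degree $\ell\ge 0$ and $Q:\mathbb{R}^d\to\mathbb{R}$ is eventually non-negative. Then the class $\mathcal{A}^*_s(P;d)$ is non-empty. If, in addition, $P$ is homogeneous, i.e. there is a real number $\gamma>-d$ with $P(\delta x)=\delta^\gamma P(x)$ for all $\delta>0$ and $x\in\mathbb{R}^d$, then $$\mathbb{A}^*_s(P;d)\le\sqrt{\frac{\max\{d+\ell+\gamma,\ \ell-\gamma\}}{2\pi}}+O(1),$$ where the implied constant is universal (an absolute constant independent of $d,s,P,H,Q,\ell,\gamma$). In fact, when $s\,i^{\ell+\mathfrak{r}}=-1$ and $-d<\gamma\le-\frac d2$, one has $$\mathbb{A}^*_s(P;d)=0.$$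
   Context: The Fourier transform of $f\in L^1(\mathbb{R}^d)$ is $\widehat f(\xi)=\int_{\mathbb{R}^d}e^{-2\pi i x\cdot\xi}f(x)\,dx$. A measurable function $f:\mathbb{R}^d\to\mathbb{R}$ is eventually non-negative if $f(x)\ge 0$ for all (not merely almost all) $x$ with $|x|$ sufficiently large; in that case $r(f):=\inf\{r>0: f(x)\ge 0\text{ for all }|x|\ge r\}$. For $P$ with parity $\mathfrak{r}\in\{0,1\}$ (that is, $P(-x)=(-1)^{\mathfrak{r}}P(x)$ for all $x$) and $s\in\{+1,-1\}$, $\mathcal{A}^*_s(P;d)$ is the set of continuous real-valued $f\in L^1(\mathbb{R}^d)\setminus\{\mathbf{0}\}$ such that $\widehat f=s\,i^{\mathfrak{r}}f$, $Pf\in L^1(\mathbb{R}^d)$, $\int_{\mathbb{R}^d}Pf\le 0$, and $Pf$ is eventually non-negative. Define $\mathbb{A}^*_s(P;d)=\inf_{f\in\mathcal{A}^*_s(P;d)}r(Pf)$. *)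

theory Defs
  imports "HOL-Analysis.Analysis"
begin

text \<open>
  The dimension \<open>d\<close> has to be an ordinary variable, since one constant must serve all
  dimensions at once. A point of \<open>d\<close>-space is therefore an extensional function
  \<open>x :: nat \<Rightarrow> real\<close> on \<open>{..<d}\<close>. This set is the topspace of the library's
  \<open>powertop_real {..<d}\<close> and the space of the product measure on \<open>{..<d}\<close>. Functions
  on \<open>d\<close>-space are total HOL functions of which only the values on \<open>Rn d\<close> matter.
\<close>

definition Rn :: "nat \<Rightarrow> (nat \<Rightarrow> real) set" where
  "Rn d = {..<d} \<rightarrow>\<^sub>E UNIV"

definition rscale :: "nat \<Rightarrow> real \<Rightarrow> (nat \<Rightarrow> real) \<Rightarrow> (nat \<Rightarrow> real)" where
  "rscale d c x = (\<lambda>i\<in>{..<d}. c * x i)"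

definition rzero :: "nat \<Rightarrow> nat \<Rightarrow> real" where
  "rzero d = (\<lambda>i\<in>{..<d}. 0)"

definition rinner :: "nat \<Rightarrow> (nat \<Rightarrow> real) \<Rightarrow> (nat \<Rightarrow> real) \<Rightarrow> real" where
  "rinner d x y = (\<Sum>i<d. x i * y i)"

definition rnorm :: "nat \<Rightarrow> (nat \<Rightarrow> real) \<Rightarrow> real" where
  "rnorm d x = L2_set x {..<d}"

text \<open>Lebesgue measure: the completion of the product of the Borel measures.\<close>

definition leb :: "nat \<Rightarrow> (nat \<Rightarrow> real) measure" where
  "leb d = completion (\<Pi>\<^sub>M i\<in>{..<d}. lborel)"

definition locally_integrable :: "nat \<Rightarrow> ((nat \<Rightarrow> real) \<Rightarrow> real) \<Rightarrow> bool" where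
  "locally_integrable d f \<longleftrightarrow>
     (\<forall>K. compactin (powertop_real {..<d}) K \<longrightarrow> set_integrable (leb d) K f)"

definition fourier :: "nat \<Rightarrow> ((nat \<Rightarrow> real) \<Rightarrow> complex) \<Rightarrow> (nat \<Rightarrow> real) \<Rightarrow> complex" where
  "fourier d f \<xi> =
     (LINT x|leb d. exp (- 2 * complex_of_real pi * \<i> * complex_of_real (rinner d x \<xi>)) * f x)"

definition homogeneous_polynomial :: "nat \<Rightarrow> nat \<Rightarrow> ((nat \<Rightarrow> real) \<Rightarrow> real) \<Rightarrow> bool" where
  "homogeneous_polynomial d l H \<longleftrightarrow>
     (\<exists>A c. finite A \<and> (\<forall>\<alpha>\<in>A. (\<Sum>i<d. \<alpha> i) = l) \<and>
        (\<forall>x\<in>Rn d. H x = (\<Sum>\<alpha>\<in>A. c \<alpha> * (\<Prod>i<d. x i ^ (\<alpha> i :: nat)))))"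

definition partial_deriv :: "nat \<Rightarrow> ((nat \<Rightarrow> real) \<Rightarrow> real) \<Rightarrow> (nat \<Rightarrow> real) \<Rightarrow> real" where
  "partial_deriv i F x = deriv (\<lambda>t. F (x(i := t))) (x i)"

text \<open>Only applied to polynomials, so no smoothness requirement is included.\<close>

definition harmonic :: "nat \<Rightarrow> ((nat \<Rightarrow> real) \<Rightarrow> real) \<Rightarrow> bool" where
  "harmonic d H \<longleftrightarrow>
     (\<forall>x\<in>Rn d. (\<Sum>i<d. partial_deriv i (partial_deriv i H) x) = 0)"

definition eventually_nonneg :: "nat \<Rightarrow> ((nat \<Rightarrow> real) \<Rightarrow> real) \<Rightarrow> bool" where
  "eventually_nonneg d f \<longleftrightarrow>
     f \<in> borel_measurable (leb d) \<and> (\<exists>R. \<forall>x\<in>Rn d. rnorm d x \<ge> R \<longrightarrow> f x \<ge> 0)"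

definition last_sign_change :: "nat \<Rightarrow> ((nat \<Rightarrow> real) \<Rightarrow> real) \<Rightarrow> real" where
  "last_sign_change d f = Inf {r. r > 0 \<and> (\<forall>x\<in>Rn d. rnorm d x \<ge> r \<longrightarrow> f x \<ge> 0)}"

text \<open>The parity \<open>r\<close> is determined by \<open>P\<close> when \<open>P\<close> is not identically zero.\<close>

definition sign_class ::
  "real \<Rightarrow> nat \<Rightarrow> ((nat \<Rightarrow> real) \<Rightarrow> real) \<Rightarrow> nat \<Rightarrow> ((nat \<Rightarrow> real) \<Rightarrow> real) set" where
  "sign_class s r P d = {f.
     continuous_map (powertop_real {..<d}) euclideanreal f \<and>
     integrable (leb d) f \<and>
     (\<exists>x\<in>Rn d. f x \<noteq> 0) \<and>
     (\<forall>\<xi>\<in>Rn d. fourier d (\<lambda>x. complex_of_real (f x)) \<xi> =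
        complex_of_real s * \<i> ^ r * complex_of_real (f \<xi>)) \<and>
     integrable (leb d) (\<lambda>x. P x * f x) \<and>
     (LINT x|leb d. P x * f x) \<le> 0 \<and>
     eventually_nonneg d (\<lambda>x. P x * f x)}"

definition sign_inf :: "real \<Rightarrow> nat \<Rightarrow> ((nat \<Rightarrow> real) \<Rightarrow> real) \<Rightarrow> nat \<Rightarrow> real" where
  "sign_inf s r P d = (INF f\<in>sign_class s r P d. last_sign_change d (\<lambda>x. P x * f x))"

end

theory Submission
  imports Defs "HOL-Probability.Characteristic_Functions" "HOL-Real_Asymp.Real_Asymp"
begin

text \<open>
  The test functions are harmonic polynomials times radial combinations of gaussians. By the
  formula of Hecke and Bochner (\<open>hecke_gaussian\<close>), the Fourier transform maps
  \<open>H(x) exp (-\<pi> L |x|\<^sup>2)\<close> to \<open>(-i)\<^sup>l L powr -(d/2 + l) H(\<xi>) exp (-\<pi> |\<xi>|\<^sup>2 / L)\<close>. So \<open>H\<close> times the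
  radial function
    \<open>\<psi>\<^sub>L = exp (-\<pi> L |x|\<^sup>2) + \<epsilon> L powr -(d/2 + l) exp (-\<pi> |x|\<^sup>2 / L)\<close>,  \<open>\<epsilon> = \<plusminus>1\<close>,
  called \<open>profile\<close> below, is an eigenfunction with eigenvalue \<open>(-i)\<^sup>l \<epsilon>\<close>. This is the required
  \<open>s i\<^sup>r\<close> for \<open>\<epsilon> = s i\<^sup>l\<^sup>+\<^sup>r\<close>, which is real exactly when \<open>P\<close> and \<open>H\<close> have the same parity.

  In that case \<open>P (H \<phi>) = H\<^sup>2 Q \<phi>\<close>, so the sign of \<open>P f\<close> far out is the sign of the radial
  factor \<open>\<phi>\<close>. For \<open>L < M < 1\<close> the function \<open>\<psi>\<^sub>L - c \<psi>\<^sub>M\<close> is eventually positive for every real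
  \<open>c\<close>, since its slowest gaussian is \<open>exp (-\<pi> L |x|\<^sup>2)\<close>. If the integral of \<open>P H \<psi>\<^sub>M\<close> is
  positive, a suitable \<open>c\<close> makes the integral of \<open>P f\<close> vanish; otherwise \<open>f = H \<psi>\<^sub>M\<close> will do. If
  the parities differ, then \<open>P H = H\<^sup>2 Q\<close> is odd and non-negative far out, so \<open>P\<close> vanishes there,
  and any rapidly decreasing eigenfunction or its negative lies in the class; \<open>x\<^sub>0\<^sup>r\<close> replaces \<open>H\<close> in
  its construction.

  For \<open>P\<close> homogeneous of degree \<open>\<gamma>\<close>, dilation gives \<open>\<integral> P H \<psi>\<^sub>L = I (L powr -a + \<epsilon> L powr -b)\<close> with
  \<open>a = (d + l + \<gamma>)/2\<close>, \<open>b = (l - \<gamma>)/2\<close> and \<open>I \<ge> 0\<close>, where \<open>a + b = d/2 + l\<close>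
  (\<open>weighted_moment_eq\<close>). Three choices of the radial factor give the bounds.
  \<^item> \<open>\<epsilon> = -1\<close> and \<open>a \<le> b\<close>, that is \<open>\<gamma> \<le> -d/2\<close>: the integral of \<open>P H \<psi>\<^sub>L\<close> is already non-positive
    for each \<open>L < 1\<close>, and the only sign change of \<open>\<psi>\<^sub>L\<close> tends to the origin as \<open>L\<close> tends to 0.
  \<^item> \<open>\<epsilon> = 1\<close>: take \<open>\<psi>\<^sub>L - c \<psi>\<^sub>1\<close> of integral 0. With \<open>m = max a b\<close> one has \<open>c \<le> L powr -m\<close>, so the
    function is positive once \<open>(1 - L) \<pi> |x|\<^sup>2 \<ge> m ln (1/L) + ln 2\<close>. For \<open>L = exp (-t)\<close> with
    \<open>t = 1 / (1 + sqrt m)\<close> this follows from \<open>\<pi> |x|\<^sup>2 \<ge> m + O(sqrt m + 1)\<close>.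
  \<^item> \<open>\<epsilon> = -1\<close> and \<open>a > b\<close>: take \<open>\<psi>\<^sub>L - c \<psi>\<^sub>M\<close> of integral 0 with \<open>L = M\<^sup>2\<close>. Then
    \<open>c = M powr -a + M powr -b\<close>, the bound \<open>d/2 + l \<le> 2a\<close> controls the negative part of \<open>\<psi>\<^sub>L\<close>, and
    a scale of the same order leads again to \<open>\<pi> |x|\<^sup>2 \<ge> a + O(sqrt a + 1)\<close>.

  In the last two cases the square root turns \<open>m + O(sqrt m + 1)\<close> into \<open>sqrt m + O(1)\<close> with a
  constant that is independent of all data.
\<close>

section \<open>Fourier transforms of one-dimensional gaussians with monomial factors\<close>

text \<open>
  One term of the exponential series dominates \<open>(x\<^sup>2) ^ n\<close>, and the summand 1 covers \<open>\<bar>x\<bar> \<le> 1\<close>, where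
  \<open>\<bar>x\<bar> ^ n\<close> may exceed \<open>(x\<^sup>2) ^ n\<close>. Used whenever polynomial growth has to be absorbed by part of a gaussian.
\<close>
lemma power_le_exp_square:
  fixes k x :: real
  assumes "k > 0"
  shows "\<bar>x\<bar> ^ n \<le> (1 + fact n / k ^ n) * exp (k * x\<^sup>2)"
proof -
  have "\<bar>x\<bar> ^ n \<le> 1 + (x\<^sup>2) ^ n"
  proof (cases "\<bar>x\<bar> \<le> 1")
    case True
    then have "\<bar>x\<bar> ^ n \<le> 1" by (simp add: power_le_one)
    then show ?thesis by (simp add: add_increasing2)
  next
    case False
    then have "\<bar>x\<bar> ^ n \<le> (\<bar>x\<bar>\<^sup>2) ^ n"
      by (intro power_mono self_le_power) auto
    then show ?thesis by simp
  qed
  moreover have "(k * x\<^sup>2) ^ n / fact n \<le> exp (k * x\<^sup>2)"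
  proof -
    have "(\<Sum>j\<in>{n}. inverse (fact j) * (k * x\<^sup>2) ^ j) \<le> (\<Sum>j. inverse (fact j) * (k * x\<^sup>2) ^ j)"
      by (rule sum_le_suminf) (use assms in \<open>auto intro: summable_exp mult_nonneg_nonneg\<close>)
    then show ?thesis by (simp add: exp_def divide_inverse mult.commute)
  qed
  then have "(x\<^sup>2) ^ n \<le> fact n / k ^ n * exp (k * x\<^sup>2)"
    using assms by (simp add: power_mult_distrib field_simps)
  moreover have "1 \<le> exp (k * x\<^sup>2)" using assms by simp
  ultimately have "\<bar>x\<bar> ^ n \<le> exp (k * x\<^sup>2) + fact n / k ^ n * exp (k * x\<^sup>2)"
    by linarith
  then show ?thesis by (simp add: ring_distribs)
qed

definition osc_gauss :: "real \<Rightarrow> real \<Rightarrow> real \<Rightarrow> complex" where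
  "osc_gauss L \<xi> x = of_real (exp (- pi * L * x\<^sup>2)) * exp (- 2 * of_real pi * \<i> * of_real (x * \<xi>))"

text \<open>
  The heat polynomials: \<open>heat_poly n t\<close> is the image of \<open>y ^ n\<close> under \<open>exp (t (d/dy)\<^sup>2)\<close>. The
  recursion is the three-term recurrence of (rescaled) Hermite polynomials, and it is the form in
  which integration by parts produces them.
\<close>
fun heat_poly :: "nat \<Rightarrow> complex \<Rightarrow> complex \<Rightarrow> complex" where
  "heat_poly 0 t y = 1"
| "heat_poly (Suc 0) t y = y"
| "heat_poly (Suc (Suc n)) t y = y * heat_poly (Suc n) t y + 2 * t * of_nat (Suc n) * heat_poly n t y"

lemma heat_poly_zero: "heat_poly n 0 y = y ^ n"
  by (induction n "0 :: complex" y rule: heat_poly.induct) auto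

text \<open>
  The heat equation: the right-hand side is also the second derivative in \<open>y\<close>, since
  \<open>n (n - 1) y ^ (n - 2)\<close> is that of \<open>y ^ n\<close> and the operators commute.
\<close>
lemma heat_poly_has_derivative:
  "((\<lambda>t. heat_poly n t y) has_field_derivative
     of_nat n * of_nat (n - 1) * heat_poly (n - 2) t y) (at t)"
proof (induction n t y rule: heat_poly.induct)
  case (3 n t y)
  show ?case
  proof (cases n)
    case 0
    show ?thesis unfolding 0 by (auto intro!: derivative_eq_intros)
  next
    case (Suc m)
    show ?thesis
    proof (cases m)
      case 0
      show ?thesis unfolding Suc 0 
        by (auto intro!: derivative_eq_intros)
    next
      case (Suc k)
      note * = 3[unfolded \<open>n = Suc m\<close> Suc]
      have "((\<lambda>t. y * heat_poly (Suc (Suc (Suc k))) t y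
              + t * (2 * of_nat (Suc (Suc (Suc k))) * heat_poly (Suc (Suc k)) t y))
          has_field_derivative
            y * (of_nat (Suc (Suc (Suc k))) * of_nat (Suc (Suc k)) * heat_poly (Suc k) t y)
            + (t * (2 * of_nat (Suc (Suc (Suc k))) * (of_nat (Suc (Suc k)) * of_nat (Suc k) * heat_poly k t y))
            + 1 * (2 * of_nat (Suc (Suc (Suc k))) * heat_poly (Suc (Suc k)) t y))) (at t)"
        using * by (intro DERIV_add DERIV_mult' DERIV_cmult DERIV_ident) (simp_all del: heat_poly.simps)
      then show ?thesis unfolding \<open>n = Suc m\<close> Suc
        by (simp add: algebra_simps)
    qed
  qed
qed (auto intro!: derivative_eq_intros)

lemma norm_osc_gauss: "norm (osc_gauss L \<xi> x) = exp (- pi * L * x\<^sup>2)"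
  by (simp add: osc_gauss_def norm_mult)

lemma osc_gauss_measurable [measurable]: "osc_gauss L \<xi> \<in> borel_measurable borel"
  unfolding osc_gauss_def by measurable

lemma integrable_power_osc_gauss:
  assumes "L > 0"
  shows "integrable lborel (\<lambda>x. of_real (x ^ n) * osc_gauss L \<xi> x)"
proof -
  define \<sigma> where "\<sigma> = sqrt (1 / (2 * pi * L))"
  have s: "\<sigma> > 0" "\<sigma>\<^sup>2 = 1 / (2 * pi * L)" using assms by (auto simp: \<sigma>_def)
  have "integrable lborel (\<lambda>x. normal_density 0 \<sigma> x * (x - 0) ^ n)"
    by (rule integrable_normal_moment[OF s(1)])
  then have "integrable lborel (\<lambda>x. sqrt (2 * pi * \<sigma>\<^sup>2) * (normal_density 0 \<sigma> x * x ^ n))"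
    by (intro integrable_mult_right) auto
  also have "(\<lambda>x. sqrt (2 * pi * \<sigma>\<^sup>2) * (normal_density 0 \<sigma> x * x ^ n))
      = (\<lambda>x. exp (- pi * L * x\<^sup>2) * x ^ n)"
    using assms s by (auto simp: normal_density_def fun_eq_iff)
  finally show ?thesis
  proof (rule Bochner_Integration.integrable_bound)
    show "AE x in lborel. norm (complex_of_real (x ^ n) * osc_gauss L \<xi> x) 
         \<le> norm (exp (- pi * L * x\<^sup>2) * x ^ n)"
      by (simp add: norm_mult norm_osc_gauss norm_power abs_mult power_abs)
  qed measurable
qed

lemma osc_gauss_has_derivative:
  "(osc_gauss L \<xi> has_vector_derivative
     of_real (- 2 * pi * L * x) * osc_gauss L \<xi> x - 2 * of_real pi * \<i> * of_real \<xi> * osc_gauss L \<xi> x) (at x)"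
proof -
  have 1: "osc_gauss L \<xi> = (\<lambda>x. exp (of_real (- pi * L * x\<^sup>2) - 2 * of_real pi * \<i> * of_real (x * \<xi>)))"
    by (auto simp: osc_gauss_def fun_eq_iff exp_of_real[symmetric] exp_add[symmetric] simp del: exp_of_real)
  have "((\<lambda>x. - pi * L * x\<^sup>2) has_real_derivative (- 2 * pi * L * x)) (at x)"
    by (auto intro!: derivative_eq_intros)
  then have 2: "((\<lambda>x. complex_of_real (- pi * L * x\<^sup>2)) has_vector_derivative of_real (- 2 * pi * L * x)) (at x)"
    by (intro has_vector_derivative_of_real) (simp add: has_real_derivative_iff_has_vector_derivative)
  have 3: "((\<lambda>x. complex_of_real (x * \<xi>)) has_vector_derivative of_real \<xi>) (at x)"
    by (intro has_vector_derivative_of_real) (auto intro!: derivative_eq_intros)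
  have 4: "((\<lambda>x. of_real (- pi * L * x\<^sup>2) - 2 * of_real pi * \<i> * of_real (x * \<xi>)) has_vector_derivative
     (of_real (- 2 * pi * L * x) - 2 * of_real pi * \<i> * of_real \<xi>)) (at x)"
    by (intro has_vector_derivative_diff 2 has_vector_derivative_mult_right 3)
  have "(exp \<circ> (\<lambda>x. of_real (- pi * L * x\<^sup>2) - 2 * of_real pi * \<i> * of_real (x * \<xi>)) has_vector_derivative
     (of_real (- 2 * pi * L * x) - 2 * of_real pi * \<i> * of_real \<xi>) * osc_gauss L \<xi> x) (at x)"
    unfolding 1 by (rule field_vector_diff_chain_at[OF 4]) (rule DERIV_exp)
  then show ?thesis unfolding 1 o_def by (simp add: algebra_simps)
qed

text \<open>
  Integration by parts: the derivative of \<open>x ^ n * osc_gauss L \<xi> x\<close> has integral zero over the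
  real line.
\<close>
lemma osc_gauss_moment_recurrence:
  fixes L \<xi> :: real
  assumes L: "L > 0"
  defines "M \<equiv> \<lambda>n. LINT x|lborel. of_real (x ^ n) * osc_gauss L \<xi> x"
  shows "M (Suc n) = of_nat n * M (n - 1) / of_real (2 * pi * L) - \<i> * of_real (\<xi> / L) * M n"
proof -
  define F where "F = (\<lambda>x. complex_of_real (x ^ n) * osc_gauss L \<xi> x)"
  define f where "f = (\<lambda>x. of_nat n * (complex_of_real (x ^ (n - 1)) * osc_gauss L \<xi> x)
     - 2 * of_real (pi * L) * (complex_of_real (x ^ Suc n) * osc_gauss L \<xi> x)
     - 2 * of_real (pi * \<xi>) * \<i> * (complex_of_real (x ^ n) * osc_gauss L \<xi> x))"
  have deriv: "(F has_vector_derivative f x) (at x)" for x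
  proof -
    have "((\<lambda>x. x ^ n) has_real_derivative (real n * x ^ (n - 1))) (at x)"
      by (auto intro!: derivative_eq_intros)
    then have 2: "((\<lambda>x. complex_of_real (x ^ n)) has_vector_derivative of_real (real n * x ^ (n - 1))) (at x)"
      by (intro has_vector_derivative_of_real) (simp add: has_real_derivative_iff_has_vector_derivative)
    show ?thesis unfolding F_def f_def
      by (rule has_vector_derivative_eq_rhs[OF has_vector_derivative_mult[OF 2 osc_gauss_has_derivative]])
         (simp add: algebra_simps)
  qed
  have cont: "isCont f x" for x
    unfolding f_def osc_gauss_def by (intro continuous_intros)
  have int: "integrable lborel f" unfolding f_def
    by (intro Bochner_Integration.integrable_diff integrable_mult_right integrable_power_osc_gauss L)
  have bound: "norm (F x) \<le> (1 + fact n / (pi * L / 2) ^ n) * exp (- (pi * L / 2 * x\<^sup>2))" for x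
  proof -
    have "norm (F x) = \<bar>x\<bar> ^ n * exp (- pi * L * x\<^sup>2)"
      by (simp add: F_def norm_mult norm_osc_gauss norm_power)
    also have "\<dots> \<le> (1 + fact n / (pi * L / 2) ^ n) * exp (pi * L / 2 * x\<^sup>2) * exp (- pi * L * x\<^sup>2)"
      by (intro mult_right_mono power_le_exp_square) (use L in auto)
    also have "\<dots> = (1 + fact n / (pi * L / 2) ^ n) * exp (- (pi * L / 2 * x\<^sup>2))"
      unfolding mult.assoc exp_add[symmetric] by (simp add: algebra_simps)
    finally show ?thesis .
  qed
  have lim: "(F \<longlongrightarrow> 0) G" if "filterlim (\<lambda>x. x\<^sup>2) at_top G" for G
  proof (rule Lim_null_comparison[OF always_eventually[OF allI, OF bound]])
    have "filterlim (\<lambda>x. - (pi * L / 2 * x\<^sup>2)) at_bot G"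
      unfolding filterlim_uminus_at_bot
      using filterlim_tendsto_pos_mult_at_top[OF tendsto_const[of "pi * L / 2"] _ that] L by simp
    from tendsto_mult_left[OF filterlim_compose[OF exp_at_bot this]]
    show "((\<lambda>x. (1 + fact n / (pi * L / 2) ^ n) * exp (- (pi * L / 2 * x\<^sup>2))) \<longlongrightarrow> 0) G"
      by (metis mult_zero_right)
  qed
  have "(LBINT x=-\<infinity>..\<infinity>. f x) = 0 - 0"
  proof (rule interval_integral_FTC_integrable)
    show "((F \<circ> real_of_ereal) \<longlongrightarrow> 0) (at_right (- \<infinity>))"
      unfolding ereal_tendsto_simps
      by (rule lim) (rule filterlim_pow_at_bot_even, auto simp: filterlim_ident)
    show "((F \<circ> real_of_ereal) \<longlongrightarrow> 0) (at_left \<infinity>)"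
      unfolding ereal_tendsto_simps
      by (rule lim) (rule filterlim_pow_at_top, auto simp: filterlim_ident)
  qed (use deriv cont int in \<open>auto simp: set_integrable_def\<close>)
  then have "(LINT x|lborel. f x) = 0"
    by (simp add: interval_lebesgue_integral_def set_lebesgue_integral_def)
  moreover have "(LINT x|lborel. f x) = of_nat n * M (n - 1) - 2 * of_real (pi * L) * M (Suc n)
      - 2 * of_real (pi * \<xi>) * \<i> * M n"
    unfolding f_def M_def
    by (simp only: Bochner_Integration.integral_diff Bochner_Integration.integrable_diff integrable_mult_right
         integrable_power_osc_gauss[OF L] integral_mult_right_zero)
  ultimately have "M (Suc n) =
      (of_nat n * M (n - 1) - 2 * of_real (pi * \<xi>) * \<i> * M n) / of_real (2 * pi * L)"
    using L by (simp add: eq_divide_eq algebra_simps)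
  also have "\<dots> = of_nat n * M (n - 1) / of_real (2 * pi * L) - \<i> * of_real (\<xi> / L) * M n"
    using L by (simp add: diff_divide_distrib)
  finally show ?thesis .
qed

text \<open>
  The characteristic function of the standard normal distribution, rescaled by \<open>sqrt (2 \<pi> L)\<close>.
\<close>
lemma integral_osc_gauss:
  assumes L: "L > 0"
  shows "(LINT x|lborel. osc_gauss L \<xi> x) = of_real (L powr (- 1 / 2) * exp (- pi * \<xi>\<^sup>2 / L))"
proof -
  define c where "c = sqrt (2 * pi * L)"
  have c: "c > 0" "c\<^sup>2 = 2 * pi * L" using L by (auto simp: c_def)
  define t where "t = - 2 * pi * \<xi> / c"
  have "(LINT x|std_normal_distribution. iexp (t * x)) = of_real (exp (- t\<^sup>2 / 2))"
    using char_std_normal_distribution unfolding char_def by meson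
  then have *: "(LINT x|lborel. std_normal_density x *\<^sub>R iexp (t * x)) = of_real (exp (- t\<^sup>2 / 2))"
    by (subst (asm) integral_density) auto
  have eq: "std_normal_density (0 + c * x) *\<^sub>R iexp (t * (0 + c * x)) = of_real (1 / sqrt (2 * pi)) * osc_gauss L \<xi> x" for x
  proof -
    have "std_normal_density (0 + c * x) = 1 / sqrt (2 * pi) * exp (- pi * L * x\<^sup>2)"
      by (simp add: normal_density_def power_mult_distrib c)
    moreover have "t * (0 + c * x) = - 2 * pi * (x * \<xi>)" using c(1) by (simp add: t_def)
    then have "iexp (t * (0 + c * x)) = exp (- 2 * of_real pi * \<i> * of_real (x * \<xi>))"
      by (simp add: mult_ac)
    ultimately show ?thesis
      by (simp add: osc_gauss_def scaleR_conv_of_real)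
  qed
  have "of_real (exp (- t\<^sup>2 / 2)) = \<bar>c\<bar> *\<^sub>R (LINT x|lborel. of_real (1 / sqrt (2 * pi)) * osc_gauss L \<xi> x)"
    using lborel_integral_real_affine[of c "\<lambda>x. std_normal_density x *\<^sub>R iexp (t * x)" 0] * c(1)
    unfolding eq by simp
  also have "\<dots> = of_real (c / sqrt (2 * pi)) * (LINT x|lborel. osc_gauss L \<xi> x)"
    using c(1) by (simp add: scaleR_conv_of_real)
  also have "c / sqrt (2 * pi) = sqrt L" by (simp add: c_def real_sqrt_mult)
  finally have *: "(LINT x|lborel. osc_gauss L \<xi> x) = of_real (exp (- t\<^sup>2 / 2) / sqrt L)"
    using L by (simp add: eq_divide_eq mult.commute)
  have e: "- t\<^sup>2 / 2 = - pi * \<xi>\<^sup>2 / L"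
    using L unfolding t_def power_divide c(2) by (simp add: power2_eq_square)
  have "L powr (- 1 / 2) = 1 / sqrt L"
    using L powr_half_sqrt[of L] powr_minus_divide[of L "1 / 2"] by simp
  then show ?thesis
    unfolding * e by simp
qed

text \<open>
  Both sides satisfy the same recursion in \<open>n\<close>. Completing the square shows where the arguments
  come from: the integral averages \<open>(x + y) ^ n\<close>, \<open>y = - i \<xi> / L\<close>, against a gaussian of
  variance \<open>2 t\<close>.
\<close>
lemma osc_gauss_moment:
  assumes L: "L > 0"
  shows "(LINT x|lborel. of_real (x ^ n) * osc_gauss L \<xi> x) =
    of_real (L powr (- 1 / 2) * exp (- pi * \<xi>\<^sup>2 / L)) *
    heat_poly n (of_real (1 / (4 * pi * L))) (- \<i> * of_real (\<xi> / L))"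
proof -
  define t y where "t = complex_of_real (1 / (4 * pi * L))" and "y = - \<i> * of_real (\<xi> / L)"
  have "(LINT x|lborel. of_real (x ^ n) * osc_gauss L \<xi> x) =
    of_real (L powr (- 1 / 2) * exp (- pi * \<xi>\<^sup>2 / L)) * heat_poly n t y"
  proof (induction n rule: less_induct)
    case (less n)
    have "z / complex_of_real (2 * pi * L) = z * (2 * t)" for z
      using L by (simp add: t_def)
    then have rec: "(LINT x|lborel. of_real (x ^ Suc k) * osc_gauss L \<xi> x) =
        of_nat k * (LINT x|lborel. of_real (x ^ (k - 1)) * osc_gauss L \<xi> x) * (2 * t)
        + y * (LINT x|lborel. of_real (x ^ k) * osc_gauss L \<xi> x)" for k
      unfolding osc_gauss_moment_recurrence[OF L, of k \<xi>] y_def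
      by (simp del: of_real_divide of_real_mult)
    consider "n = 0" | "n = Suc 0" | m where "n = Suc (Suc m)"
      by (metis not0_implies_Suc)
    then show ?case
    proof cases
      case 1
      then show ?thesis by (simp add: integral_osc_gauss[OF L])
    next
      case 2
      show ?thesis
        unfolding 2 rec[of 0] by (simp add: integral_osc_gauss[OF L])
    next
      case (3 m)
      have "m < n" "Suc m < n" using 3 by auto
      then show ?thesis
        unfolding 3 rec[of "Suc m"] diff_Suc_1 less.IH[OF \<open>m < n\<close>] less.IH[OF \<open>Suc m < n\<close>]
        by (simp only: heat_poly.simps ring_distribs mult_ac add_ac)
    qed
  qed
  then show ?thesis by (simp add: t_def y_def)
qed

section \<open>Points, dilations and the product measure\<close>

abbreviation lebesgue_product :: "nat \<Rightarrow> (nat \<Rightarrow> real) measure" where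
  "lebesgue_product d \<equiv> \<Pi>\<^sub>M i\<in>{..<d}. lborel"

lemma rnorm_sq: "(rnorm d x)\<^sup>2 = (\<Sum>i<d. (x i)\<^sup>2)"
  by (simp add: rnorm_def L2_set_def sum_nonneg)

lemma rnorm_nonneg [simp]: "0 \<le> rnorm d x"
  by (simp add: rnorm_def)

lemma abs_coordinate_le_rnorm: "i < d \<Longrightarrow> \<bar>x i\<bar> \<le> rnorm d x"
  using member_le_L2_set[of "{..<d}" i "\<lambda>i. \<bar>x i\<bar>"] by (simp add: rnorm_def L2_set_def)

lemma rnorm_eq_0:
  assumes "x \<in> Rn d" "rnorm d x = 0"
  shows "x = rzero d"
proof
  fix i
  have "x i = 0" if "i < d" using assms(2) that by (simp add: rnorm_def L2_set_eq_0_iff)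
  then show "x i = rzero d i"
    using assms(1) by (auto simp: rzero_def Rn_def PiE_def extensional_def)
qed

lemma rnorm_pos:
  assumes "x \<in> Rn d" "x \<noteq> rzero d"
  shows "rnorm d x > 0"
  using rnorm_eq_0[OF assms(1)] assms(2) rnorm_nonneg[of d x] by (metis less_le)

lemma rnorm_rscale: "\<delta> \<ge> 0 \<Longrightarrow> rnorm d (rscale d \<delta> x) = \<delta> * rnorm d x"
  by (simp add: rnorm_def rscale_def L2_set_def power_mult_distrib sum_distrib_left[symmetric] real_sqrt_mult)

lemma rscale_in_Rn [simp]: "rscale d \<delta> x \<in> Rn d"
  by (simp add: rscale_def Rn_def)

lemma rnorm_minus: "rnorm d (rscale d (- 1) x) = rnorm d x"
  by (simp add: rnorm_def rscale_def L2_set_def)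

lemma Rn_fun_upd: "x \<in> Rn d \<Longrightarrow> i < d \<Longrightarrow> x(i := t) \<in> Rn d"
  by (auto simp: Rn_def PiE_iff extensional_def)

lemma space_lebesgue_product: "space (lebesgue_product d) = Rn d"
  by (simp add: space_PiM Rn_def)

lemma space_leb [simp]: "space (leb d) = Rn d"
  by (simp add: leb_def space_lebesgue_product)

lemma sigma_finite_lborel_family: "product_sigma_finite (\<lambda>_. lborel :: real measure)"
  by standard

text \<open>
  It suffices to compare the two measures on boxes, where each coordinate contributes one factor
  \<open>\<delta>\<close>.
\<close>
lemma lebesgue_product_rscale:
  assumes \<delta>: "\<delta> > 0"
  shows "lebesgue_product d =
    density (distr (lebesgue_product d) (lebesgue_product d) (rscale d \<delta>)) (\<lambda>_. ennreal (\<delta> ^ d))"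
    (is "_ = ?N")
proof -
  interpret product_sigma_finite "\<lambda>_. lborel :: real measure" by (rule sigma_finite_lborel_family)
  have m: "rscale d \<delta> \<in> measurable (lebesgue_product d) (lebesgue_product d)"
    unfolding rscale_def[abs_def] by measurable
  have one: "emeasure lborel A = ennreal \<delta> * emeasure lborel ((\<lambda>x. \<delta> * x) -` A)" if A: "A \<in> sets borel" for A :: "real set"
  proof -
    have "emeasure lborel A = (\<integral>\<^sup>+x. indicator A x \<partial>lborel)" using A by simp
    also have "\<dots> = ennreal \<delta> * (\<integral>\<^sup>+x. indicator A (0 + \<delta> * x) \<partial>lborel)"
      using nn_integral_real_affine[of "indicator A" \<delta> 0] A \<delta> by simp
    also have "(\<lambda>x. indicator A (0 + \<delta> * x) :: ennreal) = indicator ((\<lambda>x. \<delta> * x) -` A)"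
      by (auto simp: fun_eq_iff indicator_def)
    also have "(\<integral>\<^sup>+x. indicator ((\<lambda>x. \<delta> * x) -` A) x \<partial>lborel) = emeasure lborel ((\<lambda>x. \<delta> * x) -` A)"
      using A by (intro nn_integral_indicator) (auto intro!: measurable_sets_borel[where M = borel])
    finally show ?thesis .
  qed
  have "?N = lebesgue_product d"
  proof (rule PiM_eqI)
    fix A :: "nat \<Rightarrow> real set" assume "\<And>i. i \<in> {..<d} \<Longrightarrow> A i \<in> sets lborel"
    then have A: "\<And>i. i \<in> {..<d} \<Longrightarrow> A i \<in> sets borel" by simp
    have PA: "Pi\<^sub>E {..<d} A \<in> sets (lebesgue_product d)"
      using A by (intro sets_PiM_I_finite) auto
    have "emeasure ?N (Pi\<^sub>E {..<d} A) = ennreal (\<delta> ^ d) * emeasure (distr (lebesgue_product d) (lebesgue_product d) (rscale d \<delta>)) (Pi\<^sub>E {..<d} A)"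
      using PA by (subst emeasure_density) (auto simp: nn_integral_cmult_indicator)
    also have "emeasure (distr (lebesgue_product d) (lebesgue_product d) (rscale d \<delta>)) (Pi\<^sub>E {..<d} A)
      = emeasure (lebesgue_product d) (rscale d \<delta> -` Pi\<^sub>E {..<d} A \<inter> space (lebesgue_product d))"
      using m PA by (rule emeasure_distr)
    also have "rscale d \<delta> -` Pi\<^sub>E {..<d} A \<inter> space (lebesgue_product d) = Pi\<^sub>E {..<d} (\<lambda>i. (\<lambda>x. \<delta> * x) -` A i)"
      by (auto simp: space_PiM rscale_def PiE_iff)
    also have "emeasure (lebesgue_product d) \<dots> = (\<Prod>i<d. emeasure lborel ((\<lambda>x. \<delta> * x) -` A i))"
      using A by (intro emeasure_PiM) (auto intro!: measurable_sets_borel[where M = borel])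
    also have "ennreal (\<delta> ^ d) * \<dots> = (\<Prod>i<d. ennreal \<delta> * emeasure lborel ((\<lambda>x. \<delta> * x) -` A i))"
      using \<delta> by (simp add: prod.distrib ennreal_power)
    also have "\<dots> = (\<Prod>i<d. emeasure lborel (A i))"
      by (intro prod.cong refl) (use one A in auto)
    finally show "emeasure ?N (Pi\<^sub>E {..<d} A) = (\<Prod>i<d. emeasure lborel (A i))" .
  qed auto
  then show ?thesis ..
qed

text \<open>
  Functions measurable for the completed measure are replaced by Borel functions; dilations
  preserve null sets, so the replacement is harmless on both sides.
\<close>
lemma integral_leb_rscale:
  fixes f :: "(nat \<Rightarrow> real) \<Rightarrow> real"
  assumes \<delta>: "\<delta> > 0" and f: "f \<in> borel_measurable (leb d)"
    and f': "(\<lambda>x. f (rscale d \<delta> x)) \<in> borel_measurable (leb d)"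
  shows "(LINT x|leb d. f x) = \<delta> ^ d * (LINT x|leb d. f (rscale d \<delta> x))"
proof -
  have m [measurable]: "rscale d \<delta> \<in> measurable (lebesgue_product d) (lebesgue_product d)"
    unfolding rscale_def[abs_def] by measurable
  obtain g where g: "g \<in> borel_measurable (lebesgue_product d)" and ae: "AE x in lebesgue_product d. f x = g x"
    using completion_ex_borel_measurable_real f unfolding leb_def by blast
  have "AE x in distr (lebesgue_product d) (lebesgue_product d) (rscale d \<delta>). f x = g x"
    using ae \<delta> by (subst (asm) lebesgue_product_rscale[OF \<delta>]) (simp add: AE_density)
  then have ae': "AE x in lebesgue_product d. f (rscale d \<delta> x) = g (rscale d \<delta> x)"
    by (rule AE_distrD[OF m])
  have gr: "(\<lambda>x. g (rscale d \<delta> x)) \<in> borel_measurable (lebesgue_product d)"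
    by (rule measurable_compose[OF m g])
  have "(LINT x|leb d. f x) = (LINT x|leb d. g x)"
    using f g ae unfolding leb_def by (intro integral_cong_AE AE_completion) (auto intro: measurable_completion)
  also have "\<dots> = (LINT x|lebesgue_product d. g x)"
    unfolding leb_def by (rule integral_completion) (rule g)
  also have "\<dots> = (LINT x|density (distr (lebesgue_product d) (lebesgue_product d) (rscale d \<delta>)) (\<lambda>_. ennreal (\<delta> ^ d)). g x)"
    using lebesgue_product_rscale[OF \<delta>, of d] by simp
  also have "\<dots> = (LINT x|distr (lebesgue_product d) (lebesgue_product d) (rscale d \<delta>). \<delta> ^ d *\<^sub>R g x)"
    using g \<delta> by (intro integral_density) auto
  also have "\<dots> = (LINT x|lebesgue_product d. \<delta> ^ d *\<^sub>R g (rscale d \<delta> x))"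
    using g by (intro integral_distr m) simp
  also have "\<dots> = \<delta> ^ d * (LINT x|lebesgue_product d. g (rscale d \<delta> x))" by simp
  also have "(LINT x|lebesgue_product d. g (rscale d \<delta> x)) = (LINT x|leb d. g (rscale d \<delta> x))"
    unfolding leb_def by (rule integral_completion[symmetric]) (rule gr)
  also have "\<dots> = (LINT x|leb d. f (rscale d \<delta> x))"
    using f' gr ae' unfolding leb_def
    by (intro integral_cong_AE AE_completion) (auto intro: measurable_completion simp: eq_commute)
  finally show ?thesis .
qed

section \<open>Fourier transforms of polynomials times gaussians\<close>

definition gauss :: "nat \<Rightarrow> real \<Rightarrow> (nat \<Rightarrow> real) \<Rightarrow> real" where
  "gauss d L x = exp (- L * pi * (rnorm d x)\<^sup>2)"

text \<open>
  Monomials are indexed by an arbitrary set rather than by their exponents, because the Laplacian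
  of a sum of monomials yields the same exponents for different pairs of a monomial and a
  variable.
\<close>
definition poly_fun :: "nat \<Rightarrow> 'j set \<Rightarrow> ('j \<Rightarrow> nat \<Rightarrow> nat) \<Rightarrow> ('j \<Rightarrow> real) \<Rightarrow> (nat \<Rightarrow> real) \<Rightarrow> real" where
  "poly_fun d J e c x = (\<Sum>j\<in>J. c j * (\<Prod>i<d. x i ^ e j i))"

lemma gauss_osc_product:
  "of_real (gauss d L x) * exp (- 2 * complex_of_real pi * \<i> * complex_of_real (rinner d x \<xi>))
     = (\<Prod>i<d. osc_gauss L (\<xi> i) (x i))"
proof -
  have "gauss d L x = (\<Prod>i<d. exp (- pi * L * (x i)\<^sup>2))"
    unfolding gauss_def rnorm_sq by (simp add: exp_sum sum_distrib_left mult.assoc mult.commute[of L])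
  moreover have "exp (- 2 * complex_of_real pi * \<i> * complex_of_real (rinner d x \<xi>))
      = (\<Prod>i<d. exp (- 2 * of_real pi * \<i> * of_real (x i * \<xi> i)))"
    unfolding rinner_def by (simp add: exp_sum sum_distrib_left)
  ultimately show ?thesis
    by (simp add: osc_gauss_def prod.distrib)
qed

lemma gauss_measurable_product: "gauss d L \<in> borel_measurable (lebesgue_product d)"
  unfolding gauss_def rnorm_sq by measurable

lemma poly_fun_measurable_product: "poly_fun d J e c \<in> borel_measurable (lebesgue_product d)"
  unfolding poly_fun_def by measurable

lemma rinner_measurable_product: "(\<lambda>x. rinner d x \<xi>) \<in> borel_measurable (lebesgue_product d)"
  unfolding rinner_def by measurable

lemmas product_measurable [measurable] =
  gauss_measurable_product poly_fun_measurable_product rinner_measurable_product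

context
  fixes d :: nat and L :: real
  assumes L: "L > 0"
begin

interpretation product_sigma_finite "\<lambda>_. lborel :: real measure"
  by (rule sigma_finite_lborel_family)

text \<open>
  The integrand is a product of functions of one coordinate each.
\<close>
lemma monomial_fourier_product:
  fixes \<alpha> :: "nat \<Rightarrow> nat" and \<xi> :: "nat \<Rightarrow> real"
  shows "integrable (lebesgue_product d) (\<lambda>x. \<Prod>i<d. of_real (x i ^ \<alpha> i) * osc_gauss L (\<xi> i) (x i))"
    and "(LINT x|lebesgue_product d. (\<Prod>i<d. of_real (x i ^ \<alpha> i) * osc_gauss L (\<xi> i) (x i))) =
      of_real (L powr (- real d / 2) * gauss d (1 / L) \<xi>) *
      (\<Prod>i<d. heat_poly (\<alpha> i) (of_real (1 / (4 * pi * L))) (- \<i> * of_real (\<xi> i / L)))"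
proof -
  show "integrable (lebesgue_product d) (\<lambda>x. \<Prod>i<d. of_real (x i ^ \<alpha> i) * osc_gauss L (\<xi> i) (x i))"
    by (rule product_integrable_prod[where f = "\<lambda>i x. of_real (x ^ \<alpha> i) * osc_gauss L (\<xi> i) x"])
       (auto intro!: integrable_power_osc_gauss[OF L, simplified])
  have "(LINT x|lebesgue_product d. (\<Prod>i<d. of_real (x i ^ \<alpha> i) * osc_gauss L (\<xi> i) (x i)))
     = (\<Prod>i<d. LINT x|lborel. of_real (x ^ \<alpha> i) * osc_gauss L (\<xi> i) x)"
    by (rule product_integral_prod[where f = "\<lambda>i x. of_real (x ^ \<alpha> i) * osc_gauss L (\<xi> i) x"])
       (auto intro!: integrable_power_osc_gauss[OF L, simplified])
  also have "\<dots> = of_real ((\<Prod>i<d. L powr (- 1 / 2)) * (\<Prod>i<d. exp (- pi * (\<xi> i)\<^sup>2 / L))) *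
      (\<Prod>i<d. heat_poly (\<alpha> i) (of_real (1 / (4 * pi * L))) (- \<i> * of_real (\<xi> i / L)))"
    unfolding osc_gauss_moment[OF L] by (simp add: prod.distrib)
  also have "(\<Prod>i<d. L powr (- 1 / 2)) = L powr (- real d / 2)"
    using L by (simp add: powr_power)
  also have "(\<Prod>i<d. exp (- pi * (\<xi> i)\<^sup>2 / L)) = gauss d (1 / L) \<xi>"
    unfolding gauss_def rnorm_sq by (simp add: exp_sum sum_distrib_left)
  finally show "(LINT x|lebesgue_product d. (\<Prod>i<d. of_real (x i ^ \<alpha> i) * osc_gauss L (\<xi> i) (x i))) =
      of_real (L powr (- real d / 2) * gauss d (1 / L) \<xi>) *
      (\<Prod>i<d. heat_poly (\<alpha> i) (of_real (1 / (4 * pi * L))) (- \<i> * of_real (\<xi> i / L)))" .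
qed

lemma poly_fun_osc_expand:
  "exp (- 2 * complex_of_real pi * \<i> * complex_of_real (rinner d x \<xi>)) * of_real (poly_fun d J e c x * gauss d L x)
   = (\<Sum>j\<in>J. of_real (c j) * (\<Prod>i<d. of_real (x i ^ e j i) * osc_gauss L (\<xi> i) (x i)))"
proof -
  have "exp (- 2 * complex_of_real pi * \<i> * complex_of_real (rinner d x \<xi>)) * of_real (poly_fun d J e c x * gauss d L x)
     = of_real (poly_fun d J e c x) * (\<Prod>i<d. osc_gauss L (\<xi> i) (x i))"
    unfolding gauss_osc_product[symmetric] by simp
  also have "\<dots> = (\<Sum>j\<in>J. of_real (c j) * (\<Prod>i<d. of_real (x i ^ e j i) * osc_gauss L (\<xi> i) (x i)))"
    by (simp add: poly_fun_def sum_distrib_right prod.distrib mult.assoc)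
  finally show ?thesis .
qed

lemma poly_fun_fourier:
  "integrable (lebesgue_product d) (\<lambda>x. exp (- 2 * complex_of_real pi * \<i> * complex_of_real (rinner d x \<xi>))
      * of_real (poly_fun d J e c x * gauss d L x))"
  "(LINT x|lebesgue_product d. exp (- 2 * complex_of_real pi * \<i> * complex_of_real (rinner d x \<xi>))
      * of_real (poly_fun d J e c x * gauss d L x)) =
    of_real (L powr (- real d / 2) * gauss d (1 / L) \<xi>) *
    (\<Sum>j\<in>J. of_real (c j) * (\<Prod>i<d. heat_poly (e j i) (of_real (1 / (4 * pi * L))) (- \<i> * of_real (\<xi> i / L))))"
proof -
  show "integrable (lebesgue_product d) (\<lambda>x. exp (- 2 * complex_of_real pi * \<i> * complex_of_real (rinner d x \<xi>))
      * of_real (poly_fun d J e c x * gauss d L x))"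
    unfolding poly_fun_osc_expand
    by (intro Bochner_Integration.integrable_sum integrable_mult_right monomial_fourier_product(1))
  have "(LINT x|lebesgue_product d. (\<Sum>j\<in>J. of_real (c j) * (\<Prod>i<d. of_real (x i ^ e j i) * osc_gauss L (\<xi> i) (x i))))
     = (\<Sum>j\<in>J. LINT x|lebesgue_product d. of_real (c j) * (\<Prod>i<d. of_real (x i ^ e j i) * osc_gauss L (\<xi> i) (x i)))"
    by (intro Bochner_Integration.integral_sum integrable_mult_right monomial_fourier_product(1))
  also have "\<dots> = of_real (L powr (- real d / 2) * gauss d (1 / L) \<xi>) *
    (\<Sum>j\<in>J. of_real (c j) * (\<Prod>i<d. heat_poly (e j i) (of_real (1 / (4 * pi * L))) (- \<i> * of_real (\<xi> i / L))))"
    unfolding integral_mult_right_zero monomial_fourier_product(2) sum_distrib_left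
    by (intro sum.cong refl) (simp only: mult_ac)
  finally show "(LINT x|lebesgue_product d. exp (- 2 * complex_of_real pi * \<i> * complex_of_real (rinner d x \<xi>))
      * of_real (poly_fun d J e c x * gauss d L x)) =
    of_real (L powr (- real d / 2) * gauss d (1 / L) \<xi>) *
    (\<Sum>j\<in>J. of_real (c j) * (\<Prod>i<d. heat_poly (e j i) (of_real (1 / (4 * pi * L))) (- \<i> * of_real (\<xi> i / L))))"
    unfolding poly_fun_osc_expand .
qed

lemma poly_fun_gauss_integrable: "integrable (lebesgue_product d) (\<lambda>x. poly_fun d J e c x * gauss d L x)"
proof -
  have "rinner d x (\<lambda>_. 0) = 0" for x by (simp add: rinner_def)
  with poly_fun_fourier(1)[where \<xi> = "\<lambda>_. 0" and J = J and e = e and c = c]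
  have "integrable (lebesgue_product d) (\<lambda>x. complex_of_real (poly_fun d J e c x * gauss d L x))"
    by simp
  then show ?thesis by (simp only: complex_of_real_integrable_eq)
qed

end

section \<open>The formula of Hecke and Bochner for gaussians\<close>

lemma poly_fun_fun_upd:
  assumes "i < d"
  shows "poly_fun d J e c (x(i := t)) =
    (\<Sum>j\<in>J. c j * (\<Prod>k\<in>{..<d} - {i}. x k ^ e j k) * t ^ e j i)"
proof -
  have "(\<Prod>k<d. (x(i := t)) k ^ m k) = (\<Prod>k\<in>{..<d} - {i}. x k ^ m k) * t ^ m i" for m :: "nat \<Rightarrow> nat"
    using assms by (subst prod.remove[of _ i]) (auto simp: mult.commute intro!: prod.cong)
  then show ?thesis by (simp add: poly_fun_def mult.assoc)
qed

lemma partial_deriv_twice: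
  assumes H: "\<And>x. x \<in> Rn d \<Longrightarrow> H x = poly_fun d J e c x" and x: "x \<in> Rn d" and i: "i < d"
  shows "partial_deriv i (partial_deriv i H) x =
    poly_fun d J (\<lambda>j. (e j)(i := e j i - 2)) (\<lambda>j. c j * (e j i * (e j i - 1))) x"
proof -
  define R where "R j = c j * (\<Prod>k\<in>{..<d} - {i}. x k ^ e j k)" for j
  have "H (x(i := t)) = (\<Sum>j\<in>J. R j * t ^ e j i)" for t
    using H[OF Rn_fun_upd[OF x i]] poly_fun_fun_upd[OF i] by (simp add: R_def)
  then have "partial_deriv i H (x(i := t)) = deriv (\<lambda>t. \<Sum>j\<in>J. R j * t ^ e j i) t" for t :: real
    by (simp add: partial_deriv_def)
  also have "deriv (\<lambda>t. \<Sum>j\<in>J. R j * t ^ e j i) t = (\<Sum>j\<in>J. R j * (e j i * t ^ (e j i - 1)))" for t :: real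
    by (rule DERIV_imp_deriv) (auto intro!: derivative_eq_intros simp: mult_ac)
  finally have "partial_deriv i (partial_deriv i H) x
      = deriv (\<lambda>t. \<Sum>j\<in>J. R j * (e j i * t ^ (e j i - 1))) (x i)"
    by (simp add: partial_deriv_def)
  also have "\<dots> = (\<Sum>j\<in>J. R j * (e j i * ((e j i - 1) * x i ^ (e j i - 2))))"
    by (rule DERIV_imp_deriv) (auto intro!: derivative_eq_intros simp: numeral_2_eq_2 mult_ac)
  also have "\<dots> = poly_fun d J (\<lambda>j. (e j)(i := e j i - 2)) (\<lambda>j. c j * (e j i * (e j i - 1))) (x(i := x i))"
    unfolding poly_fun_fun_upd[OF i]
    by (intro sum.cong refl) (auto simp: R_def mult_ac intro!: prod.cong)
  finally show ?thesis by simp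
qed

text \<open>
  The heat flow leaves a harmonic polynomial fixed, here at the imaginary point \<open>- i \<eta>\<close>. The
  derivative of the left side in \<open>t\<close> is the heat flow of the Laplacian of \<open>H\<close>. The Laplacian is
  known to vanish only as a function on real points, not coefficientwise; but its heat flow is,
  up to a nonzero factor, a Fourier integral against a gaussian, which sees only the function.
\<close>
lemma heat_poly_sum_constant:
  assumes H: "\<And>x. x \<in> Rn d \<Longrightarrow> H x = poly_fun d J e c x"
    and harm: "harmonic d H" and t: "t \<ge> 0"
  shows "(\<Sum>j\<in>J. of_real (c j) * (\<Prod>i<d. heat_poly (e j i) (of_real t) (- \<i> * of_real (\<eta> i))))
       = (\<Sum>j\<in>J. of_real (c j) * (\<Prod>i<d. (- \<i> * of_real (\<eta> i)) ^ e j i))"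
proof -
  define y where "y i = - \<i> * complex_of_real (\<eta> i)" for i
  define u where "u s = (\<Sum>j\<in>J. complex_of_real (c j) * (\<Prod>i<d. heat_poly (e j i) s (y i)))" for s
  define u' where "u' s = (\<Sum>j\<in>J. complex_of_real (c j) * (\<Sum>i<d.
      (of_nat (e j i) * of_nat (e j i - 1) * heat_poly (e j i - 2) s (y i)) * (\<Prod>k\<in>{..<d} - {i}. heat_poly (e j k) s (y k))))" for s
  have du: "(u has_field_derivative u' s) (at s)" for s
    unfolding u_def u'_def
    by (intro DERIV_sum DERIV_cmult has_field_derivative_prod heat_poly_has_derivative)
  have u'0: "u' (of_real s) = 0" if s: "s > 0" for s
  proof -
    \<comment> \<open>the gaussian and the frequency for which the Fourier integral is the heat flow at time
      \<open>s\<close> and at the point \<open>- i \<eta>\<close>\<close>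
    define L where "L = 1 / (4 * pi * s)"
    have L: "L > 0" "1 / (4 * pi * L) = s" using s by (auto simp: L_def)
    define K where "K = {..<d} \<times> J"
    define e' where "e' = (\<lambda>(i, j). (e j)(i := e j i - 2))"
    define c' where "c' = (\<lambda>(i, j). c j * (e j i * (e j i - 1)))"
    define \<xi> where "\<xi> i = L * \<eta> i" for i
    have y: "- \<i> * complex_of_real (\<xi> i / L) = y i" for i
      using L by (simp add: \<xi>_def y_def)
    have 0: "poly_fun d K e' c' x = 0" if x: "x \<in> Rn d" for x
    proof -
      have "poly_fun d K e' c' x = (\<Sum>i<d. \<Sum>j\<in>J. c' (i, j) * (\<Prod>k<d. x k ^ e' (i, j) k))"
        unfolding K_def poly_fun_def by (simp add: sum.cartesian_product split_def)
      also have "\<dots> = (\<Sum>i<d. partial_deriv i (partial_deriv i H) x)"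
        by (intro sum.cong refl) (simp add: partial_deriv_twice[OF H x] poly_fun_def e'_def c'_def)
      finally have "poly_fun d K e' c' x = (\<Sum>i<d. partial_deriv i (partial_deriv i H) x)" .
      then show ?thesis using harm x by (simp add: harmonic_def)
    qed
    have "0 = (LINT x|lebesgue_product d. exp (- 2 * complex_of_real pi * \<i> * complex_of_real (rinner d x \<xi>))
      * of_real (poly_fun d K e' c' x * gauss d L x))"
      by (subst Bochner_Integration.integral_cong[OF refl, where g = "\<lambda>_. 0"])
         (auto simp: space_lebesgue_product 0)
    also have "\<dots> = of_real (L powr (- real d / 2) * gauss d (1 / L) \<xi>) *
      (\<Sum>j\<in>K. of_real (c' j) * (\<Prod>i<d. heat_poly (e' j i) (of_real s) (y i)))"
      unfolding poly_fun_fourier(2)[OF L(1)] L y ..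
    finally have "(\<Sum>j\<in>K. of_real (c' j) * (\<Prod>i<d. heat_poly (e' j i) (of_real s) (y i))) = 0"
      using L by (auto simp: gauss_def)
    moreover have "(\<Sum>j\<in>K. of_real (c' j) * (\<Prod>i<d. heat_poly (e' j i) (of_real s) (y i))) = u' (of_real s)"
    proof -
      have "(\<Prod>k<d. heat_poly (e' (i, j) k) (of_real s) (y k)) = heat_poly (e j i - 2) (of_real s) (y i) *
         (\<Prod>k\<in>{..<d} - {i}. heat_poly (e j k) (of_real s) (y k))" if "i < d" for i j
        using that by (subst prod.remove[of _ i]) (auto simp: e'_def intro!: prod.cong)
      note prod_e' = this
      have "(\<Sum>j\<in>K. of_real (c' j) * (\<Prod>i<d. heat_poly (e' j i) (of_real s) (y i)))
        = (\<Sum>i<d. \<Sum>j\<in>J. of_real (c' (i, j)) * (\<Prod>k<d. heat_poly (e' (i, j) k) (of_real s) (y k)))"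
        unfolding K_def by (simp add: sum.cartesian_product split_def)
      also have "\<dots>
        = (\<Sum>i<d. \<Sum>j\<in>J. of_real (c j) * ((of_nat (e j i) * of_nat (e j i - 1) * heat_poly (e j i - 2) (of_real s) (y i)) * (\<Prod>k\<in>{..<d} - {i}. heat_poly (e j k) (of_real s) (y k))))"
        by (intro sum.cong refl) (simp add: prod_e' c'_def mult.assoc)
      also have "\<dots> = u' (of_real s)"
        unfolding u'_def sum_distrib_left by (rule sum.swap)
      finally show ?thesis .
    qed
    ultimately show ?thesis by simp
  qed
  have "u (of_real t) = u (of_real 0)"
  proof (rule has_derivative_zero_unique_strong_interval[where k = "{0}" and a = 0 and b = t and f = "\<lambda>s. u (of_real s)"])
    have du': "((\<lambda>s. u (of_real s)) has_vector_derivative u' (of_real s)) (at s within A)" for s A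
    proof -
      have "(u \<circ> of_real has_vector_derivative 1 * u' (of_real s)) (at s within A)"
        by (rule field_vector_diff_chain_within[of of_real])
           (auto intro!: derivative_eq_intros DERIV_subset[OF du])
      then show ?thesis by (simp add: o_def)
    qed
    show "continuous_on {0..t} (\<lambda>s. u (of_real s))"
      unfolding continuous_on_eq_continuous_within
      using has_vector_derivative_continuous[OF du'] by blast
    show "((\<lambda>s. u (of_real s)) has_derivative (\<lambda>h. 0)) (at x within {0..t})" if "x \<in> {0..t} - {0}" for x
      using du'[of x "{0..t}"] u'0[of x] that by (simp add: has_vector_derivative_def)
  qed (use t in auto)
  then show ?thesis by (simp add: u_def heat_poly_zero y_def)
qed

lemma fourier_product:
  assumes f: "\<And>x. x \<in> Rn d \<Longrightarrow> f x = g x" and g: "g \<in> borel_measurable (lebesgue_product d)"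
  shows "fourier d f \<xi> =
    (LINT x|lebesgue_product d. exp (- 2 * complex_of_real pi * \<i> * complex_of_real (rinner d x \<xi>)) * g x)"
proof -
  have "fourier d f \<xi> = (LINT x|leb d. exp (- 2 * complex_of_real pi * \<i> * complex_of_real (rinner d x \<xi>)) * g x)"
    unfolding fourier_def by (intro Bochner_Integration.integral_cong refl) (simp add: f)
  also have "\<dots> = (LINT x|lebesgue_product d. exp (- 2 * complex_of_real pi * \<i> * complex_of_real (rinner d x \<xi>)) * g x)"
    unfolding leb_def by (intro integral_completion borel_measurable_times g) measurable
  finally show ?thesis .
qed

text \<open>
  Summing \<open>osc_gauss_moment\<close> over the monomials of \<open>H\<close> gives the heat flow of \<open>H\<close> at time
  \<open>1 / (4 \<pi> L)\<close> and at the point \<open>- i \<xi> / L\<close>. Harmonicity removes the time, and homogeneity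
  extracts the factor \<open>(- i / L) ^ l\<close>.
\<close>
theorem hecke_gaussian:
  assumes hom: "homogeneous_polynomial d l H" and harm: "harmonic d H"
    and L: "L > 0" and \<xi>: "\<xi> \<in> Rn d"
  shows "fourier d (\<lambda>x. of_real (H x * gauss d L x)) \<xi> =
    (- \<i>) ^ l * of_real (L powr (- (real d / 2 + real l)) * (H \<xi> * gauss d (1 / L) \<xi>))"
proof -
  obtain A c where A: "\<And>\<alpha>. \<alpha> \<in> A \<Longrightarrow> (\<Sum>i<d. \<alpha> i) = l"
    and H: "\<And>x. x \<in> Rn d \<Longrightarrow> H x = poly_fun d A (\<lambda>\<alpha>. \<alpha>) c x"
    using hom unfolding homogeneous_polynomial_def poly_fun_def by blast
  have "fourier d (\<lambda>x. of_real (H x * gauss d L x)) \<xi>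
    = (LINT x|lebesgue_product d. exp (- 2 * complex_of_real pi * \<i> * complex_of_real (rinner d x \<xi>))
       * of_real (poly_fun d A (\<lambda>\<alpha>. \<alpha>) c x * gauss d L x))"
    by (rule fourier_product) (auto simp: H)
  also have "\<dots> = of_real (L powr (- real d / 2) * gauss d (1 / L) \<xi>) *
    (\<Sum>\<alpha>\<in>A. of_real (c \<alpha>) * (\<Prod>i<d. (- \<i> * of_real (\<xi> i / L)) ^ \<alpha> i))"
    unfolding poly_fun_fourier(2)[OF L]
    using heat_poly_sum_constant[OF H harm, of "1 / (4 * pi * L)" "\<lambda>i. \<xi> i / L"] L by simp
  also have "(\<Sum>\<alpha>\<in>A. of_real (c \<alpha>) * (\<Prod>i<d. (- \<i> * of_real (\<xi> i / L)) ^ \<alpha> i))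
     = (\<Sum>\<alpha>\<in>A. (- \<i>) ^ l * of_real (L powr (- real l)) * (of_real (c \<alpha>) * (\<Prod>i<d. of_real (\<xi> i) ^ \<alpha> i)))"
  proof (rule sum.cong[OF refl])
    fix \<alpha> assume "\<alpha> \<in> A"
    have "(- \<i> * complex_of_real (\<xi> i / L)) ^ \<alpha> i = (- \<i> * of_real (L powr (- 1))) ^ \<alpha> i * of_real (\<xi> i) ^ \<alpha> i" for i
      using L by (simp add: powr_minus_divide power_mult_distrib[symmetric])
    then have "(\<Prod>i<d. (- \<i> * complex_of_real (\<xi> i / L)) ^ \<alpha> i)
       = (- \<i> * of_real (L powr (- 1))) ^ (\<Sum>i<d. \<alpha> i) * (\<Prod>i<d. of_real (\<xi> i) ^ \<alpha> i)"
      by (simp add: prod.distrib power_sum)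
    also have "(\<Sum>i<d. \<alpha> i) = l" by (rule A) fact
    also have "(- \<i> * complex_of_real (L powr (- 1))) ^ l = (- \<i>) ^ l * of_real (L powr (- real l))"
    proof -
      have "(L powr (- 1)) ^ l = L powr (- real l)"
        by (subst powr_power) (use L in auto)
      then show ?thesis unfolding power_mult_distrib of_real_power[symmetric] by simp
    qed
    finally show "of_real (c \<alpha>) * (\<Prod>i<d. (- \<i> * of_real (\<xi> i / L)) ^ \<alpha> i)
      = (- \<i>) ^ l * of_real (L powr (- real l)) * (of_real (c \<alpha>) * (\<Prod>i<d. of_real (\<xi> i) ^ \<alpha> i))"
      by (simp only: mult_ac)
  qed
  also have "\<dots> = (- \<i>) ^ l * of_real (L powr (- real l)) * of_real (H \<xi>)"
    unfolding sum_distrib_left[symmetric] H[OF \<xi>] by (simp add: poly_fun_def)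
  finally have "fourier d (\<lambda>x. of_real (H x * gauss d L x)) \<xi> =
     (- \<i>) ^ l * of_real (L powr (- real d / 2) * L powr (- real l) * (H \<xi> * gauss d (1 / L) \<xi>))"
    by (simp add: mult_ac)
  also have "L powr (- real d / 2) * L powr (- real l) = L powr (- (real d / 2 + real l))"
    by (simp add: powr_add[symmetric])
  finally show ?thesis .
qed

section \<open>Fourier eigenfunctions with a harmonic factor\<close>

lemma fourier_linear:
  assumes f: "integrable (leb d) f" and g: "integrable (leb d) g"
  shows "fourier d (\<lambda>x. a * f x + b * g x) \<xi> = a * fourier d f \<xi> + b * fourier d g \<xi>"
proof -
  define E where "E x = exp (- 2 * complex_of_real pi * \<i> * complex_of_real (rinner d x \<xi>))" for x
  have E: "E \<in> borel_measurable (leb d)" unfolding leb_def E_def by (intro measurable_completion) measurable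
  have nE: "norm (E x) = 1" for x by (simp add: E_def)
  have i: "integrable (leb d) (\<lambda>x. E x * h x)" if "integrable (leb d) h" for h
    using that
    by (rule Bochner_Integration.integrable_bound)
       (use E that in \<open>auto simp: norm_mult nE intro!: borel_measurable_times borel_measurable_integrable\<close>)
  have "fourier d (\<lambda>x. a * f x + b * g x) \<xi> = (LINT x|leb d. a * (E x * f x) + b * (E x * g x))"
    unfolding fourier_def E_def by (simp add: algebra_simps)
  also have "\<dots> = a * (LINT x|leb d. E x * f x) + b * (LINT x|leb d. E x * g x)"
    using i[OF f] i[OF g] by (simp add: Bochner_Integration.integral_add)
  finally show ?thesis unfolding fourier_def E_def .
qed

lemma gauss_measurable [measurable]: "gauss d L \<in> borel_measurable (leb d)"
  unfolding leb_def by (intro measurable_completion) measurable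

lemma continuous_map_coordinate:
  "i < d \<Longrightarrow> continuous_map (powertop_real {..<d}) euclideanreal (\<lambda>x. x i)"
  using continuous_map_product_projection[of i "{..<d}" "\<lambda>_. euclideanreal"] by simp

lemma continuous_map_gauss: "continuous_map (powertop_real {..<d}) euclideanreal (gauss d L)"
proof -
  have 1: "continuous_map (powertop_real {..<d}) euclideanreal (\<lambda>x. - L * pi * (rnorm d x)\<^sup>2)"
    unfolding rnorm_sq
    by (intro continuous_map_real_mult continuous_map_sum continuous_map_real_pow continuous_map_coordinate)
       (auto simp: continuous_map_const)
  have "continuous_map euclideanreal euclideanreal (exp :: real \<Rightarrow> real)"
    by (auto intro: continuous_intros)
  from continuous_map_compose[OF 1 this] show ?thesis
    by (simp add: gauss_def[abs_def] o_def)
qed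

lemma continuous_map_poly_fun:
  assumes "finite J"
  shows "continuous_map (powertop_real {..<d}) euclideanreal (poly_fun d J e c)"
  unfolding poly_fun_def[abs_def] using assms
  by (intro continuous_map_real_mult continuous_map_sum continuous_map_prod continuous_map_real_pow continuous_map_coordinate)
     (auto simp: continuous_map_const)

text \<open>
  The second gaussian is the Fourier transform of the first as a radial function in dimension
  \<open>d + 2 * l\<close>; adding it with weight \<open>\<epsilon>\<close> gives an eigenfunction there.
\<close>
definition profile :: "nat \<Rightarrow> nat \<Rightarrow> real \<Rightarrow> real \<Rightarrow> (nat \<Rightarrow> real) \<Rightarrow> real" where
  "profile d l \<epsilon> L x = gauss d L x + \<epsilon> * L powr (- (real d / 2 + real l)) * gauss d (1 / L) x"

lemma poly_fun_le_gauss_inverse: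
  assumes k: "k > 0"
  shows "\<exists>K. \<forall>x. \<bar>poly_fun d J e c x\<bar> \<le> K * exp (k * (rnorm d x)\<^sup>2)"
proof -
  have "\<bar>poly_fun d J e c x\<bar> \<le> (\<Sum>j\<in>J. \<bar>c j\<bar> * (1 + fact (\<Sum>i<d. e j i) / k ^ (\<Sum>i<d. e j i))) * exp (k * (rnorm d x)\<^sup>2)" for x
  proof -
    have "\<bar>poly_fun d J e c x\<bar> \<le> (\<Sum>j\<in>J. \<bar>c j\<bar> * (\<Prod>i<d. \<bar>x i\<bar> ^ e j i))"
      unfolding poly_fun_def by (rule order.trans[OF sum_abs]) (simp add: abs_mult abs_prod power_abs)
    also have "\<dots> \<le> (\<Sum>j\<in>J. \<bar>c j\<bar> * ((1 + fact (\<Sum>i<d. e j i) / k ^ (\<Sum>i<d. e j i)) * exp (k * (rnorm d x)\<^sup>2)))"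
    proof (intro sum_mono mult_left_mono)
      fix j
      have "(\<Prod>i<d. \<bar>x i\<bar> ^ e j i) \<le> (\<Prod>i<d. rnorm d x ^ e j i)"
        by (intro prod_mono conjI power_mono abs_coordinate_le_rnorm) auto
      also have "\<dots> = \<bar>rnorm d x\<bar> ^ (\<Sum>i<d. e j i)" by (simp add: power_sum)
      also have "\<dots> \<le> (1 + fact (\<Sum>i<d. e j i) / k ^ (\<Sum>i<d. e j i)) * exp (k * (rnorm d x)\<^sup>2)"
        by (rule power_le_exp_square) (rule k)
      finally show "(\<Prod>i<d. \<bar>x i\<bar> ^ e j i) \<le> \<dots>" .
    qed auto
    finally show ?thesis by (simp add: sum_distrib_right mult.assoc)
  qed
  then show ?thesis by blast
qed

text \<open>
  \<open>P\<close> and \<open>H\<close> are independent parameters, because the test functions are not always built from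
  the harmonic factor of \<open>P\<close>: if its parity differs from that of \<open>P\<close>, another harmonic polynomial
  takes its place.
\<close>
locale weighted_harmonic =
  fixes d l :: nat and H P :: "(nat \<Rightarrow> real) \<Rightarrow> real"
  assumes hom: "homogeneous_polynomial d l H" and harm: "harmonic d H"
    and P_measurable [measurable]: "P \<in> borel_measurable (leb d)"
    and P_gauss_integrable: "\<And>a. a > 0 \<Longrightarrow> integrable (leb d) (\<lambda>x. P x * exp (- a * pi * (rnorm d x)\<^sup>2))"
begin

lemma H_poly_fun:
  obtains A c where "finite A" "\<And>\<alpha>. \<alpha> \<in> A \<Longrightarrow> (\<Sum>i<d. \<alpha> i) = l"
    "\<And>x. x \<in> Rn d \<Longrightarrow> H x = poly_fun d A (\<lambda>\<alpha>. \<alpha>) c x"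
  using hom unfolding homogeneous_polynomial_def poly_fun_def by blast

lemma H_measurable [measurable]: "H \<in> borel_measurable (leb d)"
proof -
  obtain A c where H: "\<And>x. x \<in> Rn d \<Longrightarrow> H x = poly_fun d A (\<lambda>\<alpha>. \<alpha>) c x"
    by (rule H_poly_fun) blast
  have "poly_fun d A (\<lambda>\<alpha>. \<alpha>) c \<in> borel_measurable (leb d)"
    unfolding leb_def by (intro measurable_completion) measurable
  then show ?thesis by (subst measurable_cong[where g = "poly_fun d A (\<lambda>\<alpha>. \<alpha>) c"]) (auto simp: H)
qed

lemma H_gauss_integrable:
  assumes "L > 0"
  shows "integrable (leb d) (\<lambda>x. H x * gauss d L x)"
proof -
  obtain A c where H: "\<And>x. x \<in> Rn d \<Longrightarrow> H x = poly_fun d A (\<lambda>\<alpha>. \<alpha>) c x"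
    by (rule H_poly_fun) blast
  have "integrable (leb d) (\<lambda>x. poly_fun d A (\<lambda>\<alpha>. \<alpha>) c x * gauss d L x)"
    unfolding leb_def
    by (subst integrable_completion) (use poly_fun_gauss_integrable[OF assms] in auto)
  then show ?thesis
    by (subst Bochner_Integration.integrable_cong[OF refl, where g = "\<lambda>x. poly_fun d A (\<lambda>\<alpha>. \<alpha>) c x * gauss d L x"]) (auto simp: H)
qed

text \<open>
  Half of the gaussian absorbs the growth of \<open>H\<close>; the other half makes \<open>P\<close> integrable.
\<close>
lemma P_H_gauss_integrable:
  assumes L: "L > 0"
  shows "integrable (leb d) (\<lambda>x. P x * (H x * gauss d L x))"
proof -
  obtain A c where H: "\<And>x. x \<in> Rn d \<Longrightarrow> H x = poly_fun d A (\<lambda>\<alpha>. \<alpha>) c x"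
    by (rule H_poly_fun) blast
  have "L / 2 * pi > 0" using L by simp
  from poly_fun_le_gauss_inverse[OF this] obtain K where
    K: "\<And>x. \<bar>poly_fun d A (\<lambda>\<alpha>. \<alpha>) c x\<bar> \<le> K * exp (L / 2 * pi * (rnorm d x)\<^sup>2)"
    by blast
  have "integrable (leb d) (\<lambda>x. K * (P x * exp (- (L / 2) * pi * (rnorm d x)\<^sup>2)))"
    using L by (intro integrable_mult_right P_gauss_integrable) simp
  then show ?thesis
  proof (rule Bochner_Integration.integrable_bound)
    show "AE x in leb d. norm (P x * (H x * gauss d L x)) \<le> norm (K * (P x * exp (- (L / 2) * pi * (rnorm d x)\<^sup>2)))"
    proof (rule AE_I2)
      fix x assume "x \<in> space (leb d)"
      then have "\<bar>H x\<bar> * gauss d L x \<le> K * exp (L / 2 * pi * (rnorm d x)\<^sup>2) * gauss d L x"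
        using K[of x] H[of x] by (intro mult_right_mono) (auto simp: gauss_def)
      also have "\<dots> = K * exp (- (L / 2) * pi * (rnorm d x)\<^sup>2)"
        unfolding gauss_def mult.assoc exp_add[symmetric] by (simp add: algebra_simps)
      also have "\<dots> \<le> \<bar>K\<bar> * exp (- (L / 2) * pi * (rnorm d x)\<^sup>2)"
        by (intro mult_right_mono) auto
      finally have "\<bar>P x\<bar> * (\<bar>H x\<bar> * gauss d L x) \<le> \<bar>P x\<bar> * (\<bar>K\<bar> * exp (- (L / 2) * pi * (rnorm d x)\<^sup>2))"
        by (intro mult_left_mono) auto
      moreover have "\<bar>gauss d L x\<bar> = gauss d L x" by (simp add: gauss_def)
      ultimately show "norm (P x * (H x * gauss d L x)) \<le> norm (K * (P x * exp (- (L / 2) * pi * (rnorm d x)\<^sup>2)))"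
        by (simp add: abs_mult mult_ac)
    qed
  qed measurable
qed

lemma H_gauss_continuous: "continuous_map (powertop_real {..<d}) euclideanreal (\<lambda>x. H x * gauss d L x)"
proof -
  obtain A c where A: "finite A" and H: "\<And>x. x \<in> Rn d \<Longrightarrow> H x = poly_fun d A (\<lambda>\<alpha>. \<alpha>) c x"
    by (rule H_poly_fun) blast
  have "continuous_map (powertop_real {..<d}) euclideanreal (\<lambda>x. poly_fun d A (\<lambda>\<alpha>. \<alpha>) c x * gauss d L x)"
    by (intro continuous_map_real_mult continuous_map_poly_fun continuous_map_gauss A)
  then show ?thesis
    by (rule continuous_map_eq) (simp add: H Rn_def)
qed

lemma H_rscale: "x \<in> Rn d \<Longrightarrow> H (rscale d \<delta> x) = \<delta> ^ l * H x"
proof -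
  assume x: "x \<in> Rn d"
  obtain A c where A: "\<And>\<alpha>. \<alpha> \<in> A \<Longrightarrow> (\<Sum>i<d. \<alpha> i) = l" and H: "\<And>x. x \<in> Rn d \<Longrightarrow> H x = poly_fun d A (\<lambda>\<alpha>. \<alpha>) c x"
    by (rule H_poly_fun) blast
  have "rscale d \<delta> x \<in> Rn d" by (simp add: rscale_def Rn_def)
  moreover have "(\<Prod>i<d. rscale d \<delta> x i ^ \<alpha> i) = \<delta> ^ l * (\<Prod>i<d. x i ^ \<alpha> i)" if "\<alpha> \<in> A" for \<alpha>
    using A[OF that] by (simp add: rscale_def power_mult_distrib prod.distrib power_sum[symmetric])
  ultimately show ?thesis using x
    by (auto simp: H poly_fun_def sum_distrib_left mult_ac intro!: sum.cong)
qed

text \<open>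
  The coefficient \<open>b\<close> is 1 except when \<open>P\<close> vanishes far out, where the sign of the test function
  is chosen by the sign of its integral.
\<close>
definition profile_comb :: "real \<Rightarrow> real \<Rightarrow> real \<Rightarrow> real \<Rightarrow> real \<Rightarrow> (nat \<Rightarrow> real) \<Rightarrow> real" where
  "profile_comb \<epsilon> b L c M x = b * profile d l \<epsilon> L x - c * profile d l \<epsilon> M x"

definition weighted_moment :: "real \<Rightarrow> real \<Rightarrow> real" where
  "weighted_moment \<epsilon> L = (LINT x|leb d. P x * (H x * profile d l \<epsilon> L x))"

context
  fixes L :: real assumes L: "L > 0"
begin

lemma H_profile_integrable: "integrable (leb d) (\<lambda>x. H x * profile d l \<epsilon> L x)"
proof -
  have "integrable (leb d) (\<lambda>x. H x * gauss d L x + \<epsilon> * L powr (- (real d / 2 + real l)) * (H x * gauss d (1 / L) x))"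
    using L by (intro Bochner_Integration.integrable_add integrable_mult_right H_gauss_integrable) auto
  then show ?thesis by (simp add: profile_def algebra_simps)
qed

lemma P_H_profile_integrable: "integrable (leb d) (\<lambda>x. P x * (H x * profile d l \<epsilon> L x))"
proof -
  have "integrable (leb d) (\<lambda>x. P x * (H x * gauss d L x) + \<epsilon> * L powr (- (real d / 2 + real l)) * (P x * (H x * gauss d (1 / L) x)))"
    using L by (intro Bochner_Integration.integrable_add integrable_mult_right P_H_gauss_integrable) auto
  then show ?thesis by (simp add: profile_def algebra_simps)
qed

text \<open>
  The Fourier transform exchanges the two gaussians of the profile, because the exponents of \<open>L\<close>
  and \<open>1 / L\<close> cancel and \<open>\<epsilon>\<^sup>2 = 1\<close>.
\<close>
lemma fourier_H_profile:
  assumes \<epsilon>: "\<epsilon> * \<epsilon> = 1" and \<xi>: "\<xi> \<in> Rn d"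
  shows "fourier d (\<lambda>x. of_real (H x * profile d l \<epsilon> L x)) \<xi> = (- \<i>) ^ l * of_real (\<epsilon> * (H \<xi> * profile d l \<epsilon> L \<xi>))"
proof -
  define D where "D = real d / 2 + real l"
  have L': "1 / L > 0" using L by simp
  have "fourier d (\<lambda>x. of_real (H x * profile d l \<epsilon> L x)) \<xi>
     = fourier d (\<lambda>x. 1 * of_real (H x * gauss d L x) + of_real (\<epsilon> * L powr (- D)) * of_real (H x * gauss d (1 / L) x)) \<xi>"
    by (simp add: profile_def D_def algebra_simps)
  also have "\<dots> = 1 * fourier d (\<lambda>x. of_real (H x * gauss d L x)) \<xi> + of_real (\<epsilon> * L powr (- D)) * fourier d (\<lambda>x. of_real (H x * gauss d (1 / L) x)) \<xi>"
    by (intro fourier_linear integrable_of_real H_gauss_integrable L L')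
  also have "\<dots> = (- \<i>) ^ l * of_real (L powr (- D) * (H \<xi> * gauss d (1 / L) \<xi>) + \<epsilon> * (L powr (- D) * (1 / L) powr (- D)) * (H \<xi> * gauss d L \<xi>))"
    unfolding hecke_gaussian[OF hom harm L \<xi>] hecke_gaussian[OF hom harm L' \<xi>] D_def
    by (simp add: algebra_simps)
  also have "L powr (- D) * (1 / L) powr (- D) = 1"
    using L by (simp add: powr_mult[symmetric])
  also have "L powr (- D) * (H \<xi> * gauss d (1 / L) \<xi>) = \<epsilon> * (H \<xi> * (\<epsilon> * L powr (- D) * gauss d (1 / L) \<xi>))"
    using \<epsilon> by (metis (no_types, opaque_lifting) mult.assoc mult.left_commute mult_1)
  finally show ?thesis by (simp add: profile_def D_def algebra_simps)
qed

end

lemma integral_P_H_profile_comb: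
  assumes "L > 0" "M > 0"
  shows "integrable (leb d) (\<lambda>x. P x * (H x * profile_comb \<epsilon> b L c M x))"
    and "(LINT x|leb d. P x * (H x * profile_comb \<epsilon> b L c M x)) = b * weighted_moment \<epsilon> L - c * weighted_moment \<epsilon> M"
proof -
  have eq: "P x * (H x * profile_comb \<epsilon> b L c M x) = b * (P x * (H x * profile d l \<epsilon> L x)) - c * (P x * (H x * profile d l \<epsilon> M x))" for x
    by (simp add: profile_comb_def algebra_simps)
  show "integrable (leb d) (\<lambda>x. P x * (H x * profile_comb \<epsilon> b L c M x))"
    unfolding eq using assms by (intro Bochner_Integration.integrable_diff integrable_mult_right P_H_profile_integrable)
  show "(LINT x|leb d. P x * (H x * profile_comb \<epsilon> b L c M x)) = b * weighted_moment \<epsilon> L - c * weighted_moment \<epsilon> M"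
    unfolding eq weighted_moment_def using assms
    by (subst Bochner_Integration.integral_diff) (auto intro!: integrable_mult_right P_H_profile_integrable)
qed

lemma profile_comb_in_sign_class:
  assumes pos: "L > 0" "M > 0" and \<epsilon>: "\<epsilon> \<in> {1, -1}" and sr: "(- \<i>) ^ l * of_real \<epsilon> = of_real s * \<i> ^ r"
    and nz: "\<exists>x\<in>Rn d. H x * profile_comb \<epsilon> b L c M x \<noteq> 0"
    and int: "b * weighted_moment \<epsilon> L - c * weighted_moment \<epsilon> M \<le> 0"
    and ev: "\<And>x. x \<in> Rn d \<Longrightarrow> rnorm d x \<ge> R \<Longrightarrow> P x * (H x * profile_comb \<epsilon> b L c M x) \<ge> 0"
  shows "(\<lambda>x. H x * profile_comb \<epsilon> b L c M x) \<in> sign_class s r P d"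
proof -
  have eq: "H x * profile_comb \<epsilon> b L c M x = b * (H x * profile d l \<epsilon> L x) - c * (H x * profile d l \<epsilon> M x)" for x
    by (simp add: profile_comb_def algebra_simps)
  have ee: "\<epsilon> * \<epsilon> = 1" using \<epsilon> by auto
  have cont: "continuous_map (powertop_real {..<d}) euclideanreal (\<lambda>x. H x * profile_comb \<epsilon> b L c M x)"
  proof -
    define D where "D = real d / 2 + real l"
    have "H x * profile_comb \<epsilon> b L c M x = b * (H x * gauss d L x) + b * \<epsilon> * L powr (- D) * (H x * gauss d (1 / L) x)
       - (c * (H x * gauss d M x) + c * \<epsilon> * M powr (- D) * (H x * gauss d (1 / M) x))" for x
      by (simp add: profile_comb_def profile_def D_def algebra_simps)
    moreover have "continuous_map (powertop_real {..<d}) euclideanreal (\<lambda>x. b * (H x * gauss d L x) + b * \<epsilon> * L powr (- D) * (H x * gauss d (1 / L) x)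
       - (c * (H x * gauss d M x) + c * \<epsilon> * M powr (- D) * (H x * gauss d (1 / M) x)))"
      by (intro continuous_map_diff continuous_map_add continuous_map_real_mult[OF _ H_gauss_continuous])
         (auto simp: continuous_map_const)
    ultimately show ?thesis by presburger
  qed
  have int': "integrable (leb d) (\<lambda>x. H x * profile_comb \<epsilon> b L c M x)"
    unfolding eq using pos by (intro Bochner_Integration.integrable_diff integrable_mult_right H_profile_integrable)
  have four: "fourier d (\<lambda>x. complex_of_real (H x * profile_comb \<epsilon> b L c M x)) \<xi> =
        complex_of_real s * \<i> ^ r * complex_of_real (H \<xi> * profile_comb \<epsilon> b L c M \<xi>)" if \<xi>: "\<xi> \<in> Rn d" for \<xi>
  proof -
    have "fourier d (\<lambda>x. complex_of_real (H x * profile_comb \<epsilon> b L c M x)) \<xi>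
      = fourier d (\<lambda>x. of_real b * of_real (H x * profile d l \<epsilon> L x) + of_real (- c) * of_real (H x * profile d l \<epsilon> M x)) \<xi>"
      unfolding eq by simp
    also have "\<dots> = of_real b * fourier d (\<lambda>x. of_real (H x * profile d l \<epsilon> L x)) \<xi> + of_real (- c) * fourier d (\<lambda>x. of_real (H x * profile d l \<epsilon> M x)) \<xi>"
      using pos by (intro fourier_linear integrable_of_real H_profile_integrable)
    also have "\<dots> = ((- \<i>) ^ l * of_real \<epsilon>) * of_real (H \<xi> * profile_comb \<epsilon> b L c M \<xi>)"
      unfolding fourier_H_profile[OF pos(1) ee \<xi>] fourier_H_profile[OF pos(2) ee \<xi>] eq
      by (simp add: algebra_simps)
    finally show ?thesis unfolding sr .
  qed
  have "eventually_nonneg d (\<lambda>x. P x * (H x * profile_comb \<epsilon> b L c M x))"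
    unfolding eventually_nonneg_def
    using borel_measurable_integrable[OF integral_P_H_profile_comb(1)[OF pos]] ev by blast
  with cont int' nz four integral_P_H_profile_comb[OF pos, of \<epsilon> b c] int show ?thesis
    unfolding sign_class_def mem_Collect_eq by (intro conjI ballI) simp_all
qed

end

section \<open>Positivity of radial profiles\<close>

text \<open>
  Among the exponents \<open>L\<close>, \<open>1 / L\<close>, \<open>M\<close>, \<open>1 / M\<close> the smallest is \<open>L\<close>, and the coefficient of its
  exponential is 1. The variable \<open>u\<close> stands for \<open>\<pi> |x|\<^sup>2\<close>, here and in the next lemmas.
\<close>
lemma profile_combination_eventually_pos:
  fixes L M p q c :: real
  assumes "0 < L" "L < M" "M < 1"
  shows "\<exists>U. \<forall>u\<ge>U. exp (- L * u) + p * exp (- u / L) - c * (exp (- M * u) + q * exp (- u / M)) > 0"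
proof -
  have pos: "1 / L - L > 0" "M - L > 0" "1 / M - L > 0"
    using assms by (auto simp: field_simps) (smt (verit) mult_le_one mult_less_cancel_left2 mult_strict_mono)+
  have lim: "((\<lambda>u::real. exp (- k * u)) \<longlongrightarrow> 0) at_top" if "k > 0" for k :: real
    using that by real_asymp
  have "((\<lambda>u. 1 + p * exp (- (1 / L - L) * u) - c * (exp (- (M - L) * u) + q * exp (- (1 / M - L) * u)))
      \<longlongrightarrow> 1 + p * 0 - c * (0 + q * 0)) at_top"
    by (intro tendsto_intros lim pos)
  then have "eventually (\<lambda>u. 1 + p * exp (- (1 / L - L) * u) - c * (exp (- (M - L) * u) + q * exp (- (1 / M - L) * u)) > 0) at_top"
    by (rule order_tendstoD) simp
  then obtain U where U: "\<And>u. u \<ge> U \<Longrightarrow> 1 + p * exp (- (1 / L - L) * u) - c * (exp (- (M - L) * u) + q * exp (- (1 / M - L) * u)) > 0"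
    unfolding eventually_at_top_linorder by blast
  have "exp (- L * u) + p * exp (- u / L) - c * (exp (- M * u) + q * exp (- u / M)) > 0" if "u \<ge> U" for u
  proof -
    have "exp (- L * u) * (1 + p * exp (- (1 / L - L) * u) - c * (exp (- (M - L) * u) + q * exp (- (1 / M - L) * u))) > 0"
      using U[OF that] by (intro mult_pos_pos) auto
    moreover have "exp (- L * u) * exp (- (1 / L - L) * u) = exp (- u / L)"
      "exp (- L * u) * exp (- (M - L) * u) = exp (- M * u)"
      "exp (- L * u) * exp (- (1 / M - L) * u) = exp (- u / M)"
      unfolding exp_add[symmetric] by (simp_all add: algebra_simps)
    ultimately show ?thesis by (simp only: ring_distribs mult.left_commute mult_1_right)
  qed
  then show ?thesis by blast
qed

text \<open>
  The zero of the difference is at \<open>u = D ln (1 / L) / (1 / L - L)\<close>, which tends to 0 with \<open>L\<close>.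
\<close>
lemma antisymmetric_profile_small_root:
  fixes D \<eta> :: real
  assumes "\<eta> > 0"
  shows "\<exists>L. 0 < L \<and> L < 1 \<and> (\<forall>u\<ge>\<eta>. exp (- L * u) - L powr (- D) * exp (- u / L) > 0)"
proof -
  have "((\<lambda>L::real. D * ln (1 / L) / (1 / L - L)) \<longlongrightarrow> 0) (at_right 0)"
    by real_asymp
  then have "eventually (\<lambda>L. D * ln (1 / L) / (1 / L - L) < \<eta>) (at_right 0)"
    by (rule order_tendstoD) (rule assms)
  moreover have "eventually (\<lambda>L::real. 0 < L \<and> L < 1) (at_right 0)"
    by (auto simp: eventually_at_right_field intro!: exI[of _ 1])
  ultimately have "eventually (\<lambda>L. D * ln (1 / L) / (1 / L - L) < \<eta> \<and> 0 < L \<and> L < 1) (at_right 0)"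
    by eventually_elim auto
  then obtain L where L: "D * ln (1 / L) / (1 / L - L) < \<eta>" "0 < L" "L < 1"
    using eventually_happens[of _ "at_right (0::real)"] by (auto simp: trivial_limit_at_right_real)
  have pos: "1 / L - L > 0"
    using L by (smt (verit) less_divide_eq_1_pos)
  have "L powr (- D) * exp (- u / L) < exp (- L * u)" if "u \<ge> \<eta>" for u
  proof -
    have "D * ln (1 / L) < u * (1 / L - L)"
      using L(1) pos that by (smt (verit) pos_divide_less_eq)
    then have "- D * ln L - u / L < - L * u"
      using L by (simp add: ln_div algebra_simps)
    then have "exp (- D * ln L - u / L) < exp (- L * u)" by simp
    moreover have "exp (- D * ln L - u / L) = L powr (- D) * exp (- u / L)"
      using L by (simp add: powr_def exp_add[symmetric])
    ultimately show ?thesis by linarith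
  qed
  then show ?thesis using L by (intro exI[of _ L]) auto
qed

text \<open>
  With \<open>L = exp (- t)\<close>, the first exponential dominates as soon as \<open>(1 - L) u \<ge> m t + ln 2\<close>. Here
  \<open>1 - L\<close> is at least \<open>t / (1 + t) = 1 / (sqrt m + 2)\<close>, while \<open>m t \<le> sqrt m\<close>; balancing the
  terms \<open>m t\<close> and \<open>1 / t\<close> in the resulting bound for \<open>u\<close> is what makes \<open>t\<close> of order
  \<open>1 / sqrt m\<close>.
\<close>
lemma symmetric_profile_pos:
  fixes m u :: real
  assumes m: "m \<ge> 0" and u: "u \<ge> (sqrt m + 2)\<^sup>2"
  defines "t \<equiv> 1 / (1 + sqrt m)"
  assumes p: "p > 0" and c: "c \<le> exp (m * t)"
  shows "exp (- exp (- t) * u) + p - c * (2 * exp (- u)) > 0"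
proof -
  define s where "s = sqrt m"
  have s: "s \<ge> 0" "m = s\<^sup>2" using m by (auto simp: s_def)
  have t: "0 < t" "t = 1 / (1 + s)" using s(1) by (auto simp: t_def s_def add_pos_nonneg)
  have u0: "u \<ge> 0" using u by (smt (verit) zero_le_power2)
  have "exp (- t) \<le> 1 / (1 + t)"
    using exp_ge_add_one_self[of t] t(1) unfolding exp_minus inverse_eq_divide
    by (intro divide_left_mono mult_pos_pos) auto
  also have "\<dots> = 1 - t / (1 + t)" using t(1) by (simp add: field_simps)
  finally have e: "1 - exp (- t) \<ge> t / (1 + t)" by simp
  have "t / (1 + t) = 1 / (s + 2)" using s unfolding t by (simp add: field_simps)
  with e have "(1 - exp (- t)) * u \<ge> 1 / (s + 2) * u"
    using u0 by (intro mult_right_mono) auto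
  moreover have "1 / (s + 2) * u \<ge> 1 / (s + 2) * (s + 2)\<^sup>2"
    using u s(1) by (intro mult_left_mono) (auto simp: s_def)
  moreover have "1 / (s + 2) * (s + 2)\<^sup>2 = s + 2" using s by (simp add: power2_eq_square)
  moreover have "m * t \<le> s" using s unfolding t by (simp add: power2_eq_square field_simps)
  moreover have "ln 2 \<le> (1::real)" using ln_2_less_1 by simp
  ultimately have "m * t + ln 2 - u \<le> - exp (- t) * u" by (simp add: algebra_simps)
  then have "exp (m * t + ln 2 - u) \<le> exp (- exp (- t) * u)" by simp
  moreover have "exp (m * t + ln 2 - u) = exp (m * t) * (2 * exp (- u))"
    by (simp add: exp_add exp_diff exp_minus divide_inverse)
  moreover have "c * (2 * exp (- u)) \<le> exp (m * t) * (2 * exp (- u))"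
    using c by (intro mult_right_mono) auto
  ultimately show ?thesis using p by linarith
qed

text \<open>
  Each of the two negative terms is at most half of the leading exponential. Both estimates follow
  from the inequality \<open>t (1 - 2 t) u \<ge> t a + 2\<close>, for which \<open>t\<close> has to be of order \<open>1 / sqrt a\<close>. The
  8 in \<open>t\<close> keeps \<open>1 - 2 t\<close> away from 0 when \<open>a\<close> is small.
\<close>
lemma antisymmetric_profile_pos:
  fixes a D u :: real
  assumes a: "a \<ge> 0" and D: "D \<le> 2 * a" and u: "u \<ge> (sqrt a + 7)\<^sup>2"
  defines "t \<equiv> 1 / (8 + sqrt a)"
  assumes q: "q > 0" and c: "0 < c" "c \<le> 2 * exp (a * t)"
  shows "exp (- exp (- 2 * t) * u) - exp (2 * t * D) * exp (- u / exp (- 2 * t)) - c * (exp (- exp (- t) * u) - q) > 0"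
proof -
  define s where "s = sqrt a"
  have s: "s \<ge> 0" "a = s\<^sup>2" using a by (auto simp: s_def)
  have t: "0 < t" "t = 1 / (8 + s)" using s(1) by (auto simp: t_def s_def add_pos_nonneg)
  have ts: "t * (8 + s) = 1" using t s by simp
  have u0: "u \<ge> 0" using u by (smt (verit) zero_le_power2)
  have key: "t * (1 - 2 * t) * u \<ge> t * a + 2"
  proof -
    have 1: "1 - 2 * t = t * (6 + s)" using ts by (simp add: algebra_simps)
    \<comment> \<open>the claim for the smallest \<open>u\<close>, multiplied by \<open>(8 + s)\<^sup>2\<close>\<close>
    have "(6 + s) * (s + 7)\<^sup>2 \<ge> (8 + s) * s\<^sup>2 + 2 * (8 + s)\<^sup>2"
      using s by (simp add: power2_eq_square algebra_simps add_nonneg_nonneg)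
    moreover have "(6 + s) * u \<ge> (6 + s) * (s + 7)\<^sup>2"
      using u s(1) by (intro mult_left_mono) (auto simp: s_def)
    ultimately have "(6 + s) * u \<ge> (8 + s) * s\<^sup>2 + 2 * (8 + s)\<^sup>2" by linarith
    then have "t * t * ((6 + s) * u) \<ge> t * t * ((8 + s) * s\<^sup>2 + 2 * (8 + s)\<^sup>2)"
      by (intro mult_left_mono) auto
    also have "t * t * ((8 + s) * s\<^sup>2 + 2 * (8 + s)\<^sup>2) = t * (t * (8 + s)) * s\<^sup>2 + 2 * (t * (8 + s))\<^sup>2"
      by (simp add: power2_eq_square algebra_simps)
    also have "\<dots> = t * a + 2" unfolding ts s(2) by simp
    finally show ?thesis unfolding 1 by (simp add: mult_ac)
  qed
  have e2: "exp (- 2 * t) \<ge> 1 - 2 * t" using exp_ge_add_one_self[of "- 2 * t"] by simp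
  have d1: "exp (- t) - exp (- 2 * t) \<ge> t * (1 - 2 * t)"
  proof -
    have "exp (- t) - exp (- 2 * t) = exp (- 2 * t) * (exp t - 1)"
      by (simp add: algebra_simps exp_add[symmetric])
    also have "\<dots> \<ge> exp (- 2 * t) * t"
      using exp_ge_add_one_self[of t] by (intro mult_left_mono) (linarith, simp)
    also have "exp (- 2 * t) * t \<ge> (1 - 2 * t) * t"
      using e2 t by (intro mult_right_mono) auto
    finally show ?thesis by (simp add: mult.commute)
  qed
  have d2: "exp (2 * t) - exp (- 2 * t) \<ge> 4 * t * (1 - 2 * t)"
  proof -
    have "exp (2 * t) - exp (- 2 * t) = exp (- 2 * t) * (exp (4 * t) - 1)"
      by (simp add: algebra_simps exp_add[symmetric])
    also have "\<dots> \<ge> exp (- 2 * t) * (4 * t)"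
      using exp_ge_add_one_self[of "4 * t"] by (intro mult_left_mono) (linarith, simp)
    also have "exp (- 2 * t) * (4 * t) \<ge> (1 - 2 * t) * (4 * t)"
      using e2 t by (intro mult_right_mono) auto
    finally show ?thesis by (simp add: mult.commute)
  qed
  have ln2: "ln 2 \<le> (1::real)" using ln_2_less_1 by simp
  have h1: "c * exp (- exp (- t) * u) \<le> exp (- exp (- 2 * t) * u) / 2"
  proof -
    have "(exp (- t) - exp (- 2 * t)) * u \<ge> t * (1 - 2 * t) * u"
      using d1 u0 by (intro mult_right_mono) auto
    with key ln2 have "a * t + 2 * ln 2 - exp (- t) * u \<le> - exp (- 2 * t) * u"
      by (simp add: algebra_simps)
    then have "exp (a * t + 2 * ln 2 - exp (- t) * u) \<le> exp (- exp (- 2 * t) * u)" by simp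
    moreover have "exp (a * t + 2 * ln 2 - exp (- t) * u) = 4 * exp (a * t) * exp (- exp (- t) * u)"
      using exp_double[of "ln 2 :: real"] by (simp add: exp_add exp_diff exp_minus divide_inverse)
    moreover have "c * exp (- exp (- t) * u) \<le> 2 * exp (a * t) * exp (- exp (- t) * u)"
      using c by (intro mult_right_mono) auto
    ultimately show ?thesis by linarith
  qed
  have h2: "exp (2 * t * D) * exp (- u / exp (- 2 * t)) \<le> exp (- exp (- 2 * t) * u) / 2"
  proof -
    have "(exp (2 * t) - exp (- 2 * t)) * u \<ge> 4 * t * (1 - 2 * t) * u"
      using d2 u0 by (intro mult_right_mono) auto
    moreover have "2 * t * D \<le> 2 * t * (2 * a)"
      using D t by (intro mult_left_mono) auto
    ultimately have "2 * t * D + ln 2 - exp (2 * t) * u \<le> - exp (- 2 * t) * u"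
      using key ln2 by (simp add: algebra_simps)
    then have "exp (2 * t * D + ln 2 - exp (2 * t) * u) \<le> exp (- exp (- 2 * t) * u)" by simp
    moreover have "exp (2 * t * D + ln 2 - exp (2 * t) * u) = 2 * (exp (2 * t * D) * exp (- u / exp (- 2 * t)))"
      by (simp add: exp_add exp_diff exp_minus divide_inverse mult_ac)
    ultimately show ?thesis by linarith
  qed
  have "c * (exp (- exp (- t) * u) - q) < c * exp (- exp (- t) * u)" using c q by simp
  with h1 h2 show ?thesis by linarith
qed

text \<open>
  Turns a bound for \<open>sqrt (\<pi> |x|\<^sup>2)\<close> into one for \<open>|x|\<close>; the additive constant is 4 because
  \<open>7 \<le> 4 sqrt \<pi>\<close>.
\<close>
lemma radius_bound:
  assumes "m \<ge> 0" "c \<le> 7" "c \<ge> 0" "x \<ge> sqrt (m / pi) + 4"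
  shows "pi * x\<^sup>2 \<ge> (sqrt m + c)\<^sup>2"
proof -
  have "(7 / 4)\<^sup>2 \<le> pi" using pi_approx by (simp add: power2_eq_square)
  then have "7 / 4 \<le> sqrt pi" by (rule real_le_rsqrt)
  then have "7 \<le> sqrt pi * 4" by simp
  have "sqrt m = sqrt pi * sqrt (m / pi)" by (simp add: real_sqrt_mult[symmetric])
  then have "sqrt m + c \<le> sqrt pi * (sqrt (m / pi) + 4)"
    using assms \<open>7 \<le> sqrt pi * 4\<close> by (simp add: ring_distribs)
  also have "\<dots> \<le> sqrt pi * x" using assms by (intro mult_left_mono) auto
  finally have "(sqrt m + c)\<^sup>2 \<le> (sqrt pi * x)\<^sup>2" using assms by (intro power_mono) auto
  then show ?thesis by (simp add: power_mult_distrib)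
qed

section \<open>The last sign change\<close>

lemma last_sign_change_nonneg:
  assumes "\<exists>R. \<forall>x\<in>Rn d. rnorm d x \<ge> R \<longrightarrow> f x \<ge> 0"
  shows "0 \<le> last_sign_change d f"
proof -
  obtain R where "\<forall>x\<in>Rn d. rnorm d x \<ge> R \<longrightarrow> f x \<ge> 0" using assms by blast
  then have "max R 1 \<in> {r. r > 0 \<and> (\<forall>x\<in>Rn d. rnorm d x \<ge> r \<longrightarrow> f x \<ge> 0)}" by simp
  then show ?thesis
    unfolding last_sign_change_def by (intro cInf_greatest) (blast, auto)
qed

lemma last_sign_change_le:
  assumes "R > 0" "\<And>x. x \<in> Rn d \<Longrightarrow> rnorm d x \<ge> R \<Longrightarrow> f x \<ge> 0"
  shows "last_sign_change d f \<le> R"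
  unfolding last_sign_change_def
  by (rule cInf_lower) (use assms in \<open>auto intro!: bdd_belowI[of _ 0]\<close>)

lemma sign_inf_nonneg: "sign_class s r P d \<noteq> {} \<Longrightarrow> 0 \<le> sign_inf s r P d"
  unfolding sign_inf_def
  by (rule cINF_greatest) (auto simp: sign_class_def eventually_nonneg_def intro!: last_sign_change_nonneg)

lemma sign_inf_le:
  assumes "f \<in> sign_class s r P d" "R > 0" "\<And>x. x \<in> Rn d \<Longrightarrow> rnorm d x \<ge> R \<Longrightarrow> P x * f x \<ge> 0"
  shows "sign_inf s r P d \<le> R"
proof -
  have "sign_inf s r P d \<le> last_sign_change d (\<lambda>x. P x * f x)"
    unfolding sign_inf_def
    by (rule cINF_lower) (use assms in \<open>auto simp: sign_class_def eventually_nonneg_def intro!: last_sign_change_nonneg bdd_belowI[of _ 0]\<close>)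
  also have "\<dots> \<le> R" by (rule last_sign_change_le) (use assms in auto)
  finally show ?thesis .
qed

section \<open>The class of eigenfunctions is non-empty\<close>

lemma profile_radial:
  "profile d l \<epsilon> L x = exp (- L * (pi * (rnorm d x)\<^sup>2)) +
     \<epsilon> * L powr (- (real d / 2 + real l)) * exp (- (pi * (rnorm d x)\<^sup>2) / L)"
  by (simp add: profile_def gauss_def mult.assoc)

text \<open>
  The point where \<open>H\<close> does not vanish is taken away from the origin so that it can be dilated to
  any radius.
\<close>
locale nonzero_weighted_harmonic = weighted_harmonic +
  fixes \<epsilon> s :: real and r :: nat
  assumes H_nonzero: "\<exists>x\<in>Rn d. rnorm d x > 0 \<and> H x \<noteq> 0"
    and \<epsilon>: "\<epsilon> \<in> {1, -1}"
    and eigenvalue: "(- \<i>) ^ l * of_real \<epsilon> = of_real s * \<i> ^ r"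
begin

lemma H_nonzero_far: "\<exists>x\<in>Rn d. rnorm d x \<ge> R \<and> H x \<noteq> 0"
proof -
  obtain x where x: "x \<in> Rn d" "rnorm d x > 0" "H x \<noteq> 0" using H_nonzero by blast
  define \<delta> where "\<delta> = max 1 (R / rnorm d x)"
  have "\<delta> > 0" by (simp add: \<delta>_def)
  moreover have "\<delta> * rnorm d x \<ge> R / rnorm d x * rnorm d x"
    unfolding \<delta>_def by (intro mult_right_mono) auto
  ultimately show ?thesis
    using x by (intro bexI[of _ "rscale d \<delta> x"]) (auto simp: rnorm_rscale H_rscale)
qed

lemma profile_comb_eventually_pos:
  assumes "0 < L" "L < M" "M < 1"
  shows "\<exists>R. \<forall>x\<in>Rn d. rnorm d x \<ge> R \<longrightarrow> profile_comb \<epsilon> 1 L c M x > 0"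
proof -
  define D where "D = real d / 2 + real l"
  obtain U where U: "\<And>u. u \<ge> U \<Longrightarrow> exp (- L * u) + \<epsilon> * L powr (- D) * exp (- u / L)
      - c * (exp (- M * u) + \<epsilon> * M powr (- D) * exp (- u / M)) > 0"
    using profile_combination_eventually_pos[OF assms] by blast
  have "profile_comb \<epsilon> 1 L c M x > 0" if "rnorm d x \<ge> max 1 U" for x
  proof -
    have "rnorm d x \<le> (rnorm d x)\<^sup>2" using that by (simp add: self_le_power)
    also have "\<dots> \<le> pi * (rnorm d x)\<^sup>2" using pi_ge_two by (simp add: mult_le_cancel_right1)
    finally have "pi * (rnorm d x)\<^sup>2 \<ge> U" using that by simp
    from U[OF this] show ?thesis by (simp add: profile_comb_def profile_radial D_def)
  qed
  then show ?thesis by blast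
qed

lemma sign_class_nonempty:
  assumes "\<And>x. x \<in> Rn d \<Longrightarrow> rnorm d x \<ge> R \<Longrightarrow> P x * H x \<ge> 0"
  shows "sign_class s r P d \<noteq> {}"
proof -
  have ex: "sign_class s r P d \<noteq> {}"
    if LM: "0 < L" "L < M" "M < 1" and int: "1 * weighted_moment \<epsilon> L - c * weighted_moment \<epsilon> M \<le> 0" for L M c
  proof -
    obtain R' where R': "\<And>x. x \<in> Rn d \<Longrightarrow> rnorm d x \<ge> R' \<Longrightarrow> profile_comb \<epsilon> 1 L c M x > 0"
      using profile_comb_eventually_pos[OF LM] by blast
    obtain x where "x \<in> Rn d" "rnorm d x \<ge> R'" "H x \<noteq> 0" using H_nonzero_far by blast
    then have nz: "\<exists>x\<in>Rn d. H x * profile_comb \<epsilon> 1 L c M x \<noteq> 0" using R'[of x] by force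
    have "P x * (H x * profile_comb \<epsilon> 1 L c M x) \<ge> 0" if "x \<in> Rn d" "rnorm d x \<ge> max R R'" for x
      using mult_nonneg_nonneg[of "P x * H x" "profile_comb \<epsilon> 1 L c M x"] that assms[of x] R'[of x] by (simp add: mult.assoc)
    note nn = this
    have "(\<lambda>x. H x * profile_comb \<epsilon> 1 L c M x) \<in> sign_class s r P d"
      by (rule profile_comb_in_sign_class[where R = "max R R'", OF _ _ \<epsilon> eigenvalue nz int nn]) (use LM in auto)
    then show ?thesis by blast
  qed
  show ?thesis
  proof (cases "weighted_moment \<epsilon> (1 / 2) \<le> 0")
    case True
    \<comment> \<open>the test function is \<open>H\<close> times the single profile at \<open>1 / 2\<close>\<close>
    then show ?thesis by (intro ex[of "1 / 2" "3 / 4" 0]) auto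
  next
    case False
    then show ?thesis by (intro ex[of "1 / 4" "1 / 2" "weighted_moment \<epsilon> (1 / 4) / weighted_moment \<epsilon> (1 / 2)"]) auto
  qed
qed

text \<open>
  Far out there is no sign condition, so an eigenfunction or its negative serves.
\<close>
lemma sign_class_nonempty_if_vanishing:
  assumes "\<And>x. x \<in> Rn d \<Longrightarrow> rnorm d x \<ge> R \<Longrightarrow> P x = 0"
  shows "sign_class s r P d \<noteq> {}"
proof -
  define b :: real where "b = (if weighted_moment \<epsilon> (1 / 2) \<le> 0 then 1 else - 1)"
  have b: "b \<noteq> 0" "b * weighted_moment \<epsilon> (1 / 2) - 0 * weighted_moment \<epsilon> (3 / 4) \<le> 0" by (auto simp: b_def)
  obtain R' where R': "\<And>x. x \<in> Rn d \<Longrightarrow> rnorm d x \<ge> R' \<Longrightarrow> profile_comb \<epsilon> 1 (1 / 2) 0 (3 / 4) x > 0"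
    using profile_comb_eventually_pos[of "1 / 2" "3 / 4" 0] by auto
  obtain x where "x \<in> Rn d" "rnorm d x \<ge> R'" "H x \<noteq> 0" using H_nonzero_far by blast
  then have nz: "\<exists>x\<in>Rn d. H x * profile_comb \<epsilon> b (1 / 2) 0 (3 / 4) x \<noteq> 0"
    using R'[of x] b(1) by (intro bexI[of _ x]) (auto simp: profile_comb_def)
  have "P x * (H x * profile_comb \<epsilon> b (1 / 2) 0 (3 / 4) x) \<ge> 0" if "x \<in> Rn d" "rnorm d x \<ge> R" for x
    using assms[OF that] by simp
  note nn = this
  have "(\<lambda>x. H x * profile_comb \<epsilon> b (1 / 2) 0 (3 / 4) x) \<in> sign_class s r P d"
    by (rule profile_comb_in_sign_class[OF _ _ \<epsilon> eigenvalue nz b(2) nn]) auto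
  then show ?thesis by blast
qed

end

section \<open>Homogeneous weights\<close>

locale homogeneous_weight = nonzero_weighted_harmonic +
  fixes \<gamma> :: real
  assumes \<gamma>: "\<gamma> > - real d"
    and P_rscale: "\<And>\<delta> x. \<delta> > 0 \<Longrightarrow> x \<in> Rn d \<Longrightarrow> P (rscale d \<delta> x) = \<delta> powr \<gamma> * P x"
    and PH_eventually_nonneg: "\<exists>R. \<forall>x\<in>Rn d. rnorm d x \<ge> R \<longrightarrow> P x * H x \<ge> 0"
begin

text \<open>
  The integral of \<open>P H exp (-\<pi> L |x|\<^sup>2)\<close> scales like \<open>L powr - moment_exponent\<close>. The second gaussian
  of the profile contributes the mirror exponent; the two add up to \<open>d / 2 + l\<close>.
\<close>
definition "moment_exponent = (real d + real l + \<gamma>) / 2"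
definition "dual_exponent = (real l - \<gamma>) / 2"

text \<open>
  The sign of \<open>P H\<close> is constant along rays, so its sign far out holds everywhere.
\<close>
lemma PH_nonneg:
  assumes x: "x \<in> Rn d" "rnorm d x > 0"
  shows "P x * H x \<ge> 0"
proof -
  obtain R where R: "\<And>x. x \<in> Rn d \<Longrightarrow> rnorm d x \<ge> R \<Longrightarrow> P x * H x \<ge> 0"
    using PH_eventually_nonneg by blast
  define \<delta> where "\<delta> = max 1 (R / rnorm d x)"
  have \<delta>: "\<delta> > 0" by (simp add: \<delta>_def)
  have "\<delta> * rnorm d x \<ge> R / rnorm d x * rnorm d x"
    unfolding \<delta>_def using x by (intro mult_right_mono) auto
  then have "P (rscale d \<delta> x) * H (rscale d \<delta> x) \<ge> 0"
    using x \<delta> by (intro R) (auto simp: rnorm_rscale)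
  then have "(\<delta> powr \<gamma> * \<delta> ^ l) * (P x * H x) \<ge> 0"
    using \<delta> x by (simp add: P_rscale H_rscale mult_ac)
  moreover have "\<delta> powr \<gamma> * \<delta> ^ l > 0" using \<delta> by simp
  ultimately show ?thesis by (metis linorder_not_le mult_pos_neg)
qed

lemma P_origin_eq_0:
  assumes "\<gamma> \<noteq> 0" "x \<in> Rn d" "rnorm d x = 0"
  shows "P x = 0"
proof -
  have "rscale d 2 x = x"
    using rnorm_eq_0[OF assms(2,3)] by (auto simp: rscale_def rzero_def)
  with P_rscale[of 2 x] assms(2) have "P x * (2 powr \<gamma> - 1) = 0" by (simp add: algebra_simps)
  moreover have "2 powr \<gamma> \<noteq> 1" using assms(1) by simp
  ultimately show ?thesis by simp
qed

text \<open>
  Dilation by \<open>sqrt L\<close> multiplies the integrand by a power of \<open>L\<close> given by homogeneity.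
\<close>
lemma gauss_moment:
  assumes L: "L > 0"
  shows "(LINT x|leb d. P x * (H x * gauss d L x)) = L powr (- moment_exponent) * (LINT x|leb d. P x * (H x * gauss d 1 x))"
proof -
  define f where "f x = P x * (H x * gauss d 1 x)" for x
  define k where "k = sqrt L powr \<gamma> * sqrt L ^ l"
  have eq: "f (rscale d (sqrt L) x) = k * (P x * (H x * gauss d L x))" if "x \<in> Rn d" for x
    using that L by (simp add: f_def k_def P_rscale H_rscale gauss_def rnorm_rscale power_mult_distrib mult_ac)
  have f: "f \<in> borel_measurable (leb d)" unfolding f_def by measurable
  have "(\<lambda>x. k * (P x * (H x * gauss d L x))) \<in> borel_measurable (leb d)" by measurable
  then have f': "(\<lambda>x. f (rscale d (sqrt L) x)) \<in> borel_measurable (leb d)"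
    by (subst measurable_cong[where g = "\<lambda>x. k * (P x * (H x * gauss d L x))"]) (auto simp: eq)
  have "(LINT x|leb d. f x) = sqrt L ^ d * (LINT x|leb d. f (rscale d (sqrt L) x))"
    using L by (intro integral_leb_rscale f f') simp
  also have "(LINT x|leb d. f (rscale d (sqrt L) x)) = (LINT x|leb d. k * (P x * (H x * gauss d L x)))"
    by (intro Bochner_Integration.integral_cong refl) (simp add: eq)
  also have "\<dots> = k * (LINT x|leb d. P x * (H x * gauss d L x))"
    by simp
  also have "sqrt L ^ d * (k * (LINT x|leb d. P x * (H x * gauss d L x))) =
      L powr moment_exponent * (LINT x|leb d. P x * (H x * gauss d L x))"
  proof -
    have "sqrt L ^ d * k = L powr moment_exponent"
    proof -
      have "sqrt L ^ d * k = sqrt L powr (real d + \<gamma> + real l)"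
        using L by (simp add: k_def powr_add powr_realpow)
      also have "\<dots> = L powr moment_exponent"
        using L by (simp add: powr_half_sqrt[symmetric] powr_powr moment_exponent_def add_ac)
      finally show ?thesis .
    qed
    then show ?thesis by simp
  qed
  finally show ?thesis
    using L unfolding f_def by (simp add: powr_minus)
qed

text \<open>
  The gaussian \<open>exp (-\<pi> |x|\<^sup>2 / L)\<close> contributes the exponent \<open>moment_exponent - (d / 2 + l)\<close>, which
  is \<open>- dual_exponent\<close>.
\<close>
lemma weighted_moment_eq:
  assumes L: "L > 0"
  shows "weighted_moment \<epsilon> L = (L powr (- moment_exponent) + \<epsilon> * L powr (- dual_exponent)) * (LINT x|leb d. P x * (H x * gauss d 1 x))"
proof -
  define D where "D = real d / 2 + real l"
  have "weighted_moment \<epsilon> L = (LINT x|leb d. P x * (H x * gauss d L x) + \<epsilon> * L powr (- D) * (P x * (H x * gauss d (1 / L) x)))"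
    unfolding weighted_moment_def profile_def D_def by (simp add: algebra_simps)
  also have "\<dots> = (LINT x|leb d. P x * (H x * gauss d L x)) + \<epsilon> * L powr (- D) * (LINT x|leb d. P x * (H x * gauss d (1 / L) x))"
    using L by (subst Bochner_Integration.integral_add) (auto intro!: integrable_mult_right P_H_gauss_integrable)
  also have "(LINT x|leb d. P x * (H x * gauss d (1 / L) x)) = (1 / L) powr (- moment_exponent) * (LINT x|leb d. P x * (H x * gauss d 1 x))"
    using L by (intro gauss_moment) simp
  also have "\<epsilon> * L powr (- D) * ((1 / L) powr (- moment_exponent) * (LINT x|leb d. P x * (H x * gauss d 1 x)))
     = \<epsilon> * (L powr (- D) * L powr moment_exponent) * (LINT x|leb d. P x * (H x * gauss d 1 x))"
    using L by (simp add: powr_divide powr_minus)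
  also have "L powr (- D) * L powr moment_exponent = L powr (- dual_exponent)"
  proof -
    have "- D + moment_exponent = - dual_exponent" by (simp add: D_def moment_exponent_def dual_exponent_def field_simps)
    then show ?thesis by (simp add: powr_add[symmetric])
  qed
  finally show ?thesis unfolding gauss_moment[OF L] by (simp add: algebra_simps)
qed

lemma sign_inf_le_profile_comb:
  assumes "L > 0" "M > 0" "R > 0"
    and int: "weighted_moment \<epsilon> L - c * weighted_moment \<epsilon> M \<le> 0"
    and pos: "\<And>x. x \<in> Rn d \<Longrightarrow> rnorm d x \<ge> R \<Longrightarrow> profile_comb \<epsilon> 1 L c M x > 0"
  shows "sign_inf s r P d \<le> R"
proof -
  obtain x where "x \<in> Rn d" "rnorm d x \<ge> R" "H x \<noteq> 0" using H_nonzero_far by blast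
  then have nz: "\<exists>x\<in>Rn d. H x * profile_comb \<epsilon> 1 L c M x \<noteq> 0" using pos[of x] by force
  have nn: "P x * (H x * profile_comb \<epsilon> 1 L c M x) \<ge> 0" if "x \<in> Rn d" "rnorm d x \<ge> R" for x
    using mult_nonneg_nonneg[of "P x * H x" "profile_comb \<epsilon> 1 L c M x"] that PH_nonneg[of x] pos[of x] \<open>R > 0\<close>
    by (simp add: mult.assoc)
  have "(\<lambda>x. H x * profile_comb \<epsilon> 1 L c M x) \<in> sign_class s r P d"
    by (rule profile_comb_in_sign_class[OF _ _ \<epsilon> eigenvalue nz _ nn]) (use assms in auto)
  then show ?thesis by (rule sign_inf_le) (use nn \<open>R > 0\<close> in auto)
qed

lemma sign_class_nonempty_homogeneous: "sign_class s r P d \<noteq> {}"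
  using PH_eventually_nonneg sign_class_nonempty by blast

text \<open>
  For \<open>L < 1\<close> the profile itself has a non-positive weighted integral, and its sign change can be
  moved arbitrarily close to the origin.
\<close>
lemma sign_inf_eq_0:
  assumes e: "\<epsilon> = - 1" and g: "\<gamma> \<le> - real d / 2" and d: "d \<ge> 1"
  shows "sign_inf s r P d = 0"
proof (rule antisym)
  have "sign_inf s r P d \<le> 0 + \<eta>" if \<eta>: "\<eta> > 0" for \<eta>
  proof -
    define D where "D = real d / 2 + real l"
    have "pi * \<eta>\<^sup>2 > 0" using \<eta> by simp
    from antisymmetric_profile_small_root[OF this, of D] obtain L where L: "0 < L" "L < 1"
      and pos: "\<And>u. u \<ge> pi * \<eta>\<^sup>2 \<Longrightarrow> exp (- L * u) - L powr (- D) * exp (- u / L) > 0" by blast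
    have "P x * H x \<ge> 0" if "x \<in> Rn d" for x
    proof (cases "rnorm d x = 0")
      case True
      \<comment> \<open>homogeneity of degree 0 would leave the value at the origin arbitrary\<close>
      moreover have "\<gamma> \<noteq> 0" using g d by auto
      ultimately show ?thesis using P_origin_eq_0 that by simp
    next
      case False
      then have "rnorm d x > 0" using rnorm_nonneg[of d x] by linarith
      then show ?thesis by (rule PH_nonneg[OF that])
    qed
    then have "0 \<le> (LINT x|leb d. P x * (H x * gauss d 1 x))"
      by (intro Bochner_Integration.integral_nonneg_AE AE_I2)
         (simp add: gauss_def mult.assoc[symmetric] zero_le_mult_iff)
    moreover have "L powr (- moment_exponent) \<le> L powr (- dual_exponent)"
      using L g by (intro powr_mono') (auto simp: moment_exponent_def dual_exponent_def)
    moreover have "weighted_moment \<epsilon> L - 0 * weighted_moment \<epsilon> 1 = (L powr (- moment_exponent) - L powr (- dual_exponent)) * (LINT x|leb d. P x * (H x * gauss d 1 x))"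
      using weighted_moment_eq[OF L(1)] by (simp add: e)
    ultimately have "weighted_moment \<epsilon> L - 0 * weighted_moment \<epsilon> 1 \<le> 0"
      by (simp only: mult_nonpos_nonneg diff_le_0_iff_le)
    then have "sign_inf s r P d \<le> \<eta>"
    proof (rule sign_inf_le_profile_comb[rotated 3])
      fix x assume "\<eta> \<le> rnorm d x"
      then have "pi * \<eta>\<^sup>2 \<le> pi * (rnorm d x)\<^sup>2" using \<eta> by (intro mult_left_mono power_mono) auto
      from pos[OF this] show "profile_comb \<epsilon> 1 L 0 1 x > 0" by (simp add: profile_comb_def profile_radial e D_def)
    qed (use L \<eta> in auto)
    then show ?thesis by simp
  qed
  then show "sign_inf s r P d \<le> 0" by (rule field_le_epsilon)
  show "0 \<le> sign_inf s r P d" by (rule sign_inf_nonneg) (rule sign_class_nonempty_homogeneous)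
qed

lemma sign_inf_le_symmetric:
  assumes e: "\<epsilon> = 1"
  shows "sign_inf s r P d \<le> sqrt (max moment_exponent dual_exponent / pi) + 4"
proof -
  define m where "m = max moment_exponent dual_exponent"
  have m: "m \<ge> 0" using \<gamma> by (simp add: m_def moment_exponent_def le_max_iff_disj)
  define t where "t = 1 / (1 + sqrt m)"
  define L where "L = exp (- t)"
  \<comment> \<open>makes the weighted integral vanish, since the profile at 1 is \<open>2 exp (-\<pi> |x|\<^sup>2)\<close>\<close>
  define c where "c = (L powr (- moment_exponent) + L powr (- dual_exponent)) / 2"
  have L: "L > 0" by (simp add: L_def)
  have t: "t \<ge> 0" using m by (simp add: t_def)
  have c: "c \<le> exp (m * t)"
  proof -
    have "exp (moment_exponent * t) \<le> exp (m * t)" "exp (dual_exponent * t) \<le> exp (m * t)"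
      using t by (auto simp: m_def intro!: mult_right_mono)
    then have "exp (moment_exponent * t) + exp (dual_exponent * t) \<le> exp (m * t) + exp (m * t)" by (rule add_mono)
    moreover have "c = (exp (moment_exponent * t) + exp (dual_exponent * t)) / 2" by (simp add: c_def L_def powr_def)
    ultimately show ?thesis by simp
  qed
  have "weighted_moment \<epsilon> L - c * weighted_moment \<epsilon> 1 = 0"
    using L unfolding weighted_moment_eq[OF L] weighted_moment_eq[OF zero_less_one] by (simp add: e c_def)
  then have "sign_inf s r P d \<le> sqrt (m / pi) + 4"
  proof (intro sign_inf_le_profile_comb[of L 1 _ c])
    fix x assume x: "rnorm d x \<ge> sqrt (m / pi) + 4"
    define u where "u = pi * (rnorm d x)\<^sup>2"
    have u: "u \<ge> (sqrt m + 2)\<^sup>2" unfolding u_def by (rule radius_bound) (use m x in auto)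
    have "exp (- exp (- t) * u) + L powr (- (real d / 2 + real l)) * exp (- u / L) - c * (2 * exp (- u)) > 0"
      unfolding t_def by (rule symmetric_profile_pos[OF m u]) (use c L in \<open>auto simp: t_def\<close>)
    then show "profile_comb \<epsilon> 1 L c 1 x > 0"
      by (simp add: profile_comb_def profile_radial e u_def[symmetric] L_def)
  qed (use L m in \<open>auto intro: add_nonneg_pos\<close>)
  then show ?thesis by (simp add: m_def)
qed

lemma sign_inf_le_antisymmetric:
  assumes e: "\<epsilon> = - 1" and g: "\<gamma> > - real d / 2"
  shows "sign_inf s r P d \<le> sqrt (moment_exponent / pi) + 4"
proof -
  define D where "D = real d / 2 + real l"
  have a: "moment_exponent \<ge> 0" "D \<le> 2 * moment_exponent" using \<gamma> g by (auto simp: moment_exponent_def D_def)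
  define t where "t = 1 / (8 + sqrt moment_exponent)"
  have t: "t > 0" using a by (simp add: t_def add_pos_nonneg)
  define L where "L = exp (- 2 * t)"
  define M where "M = exp (- t)"
  define c where "c = exp (moment_exponent * t) + exp (dual_exponent * t)"
  have pos: "L > 0" "M > 0" by (auto simp: L_def M_def)
  have c: "0 < c" "c \<le> 2 * exp (moment_exponent * t)"
  proof -
    have "exp (dual_exponent * t) \<le> exp (moment_exponent * t)" using g t by (auto simp: moment_exponent_def dual_exponent_def intro!: mult_right_mono)
    then show "c \<le> 2 * exp (moment_exponent * t)" by (simp add: c_def)
  qed (simp add: c_def add_pos_pos)
  \<comment> \<open>\<open>L = M\<^sup>2\<close>, so the left side is a difference of two squares, and \<open>c\<close> is the sum of their roots\<close>
  have "(L powr (- moment_exponent) - L powr (- dual_exponent)) = c * (M powr (- moment_exponent) - M powr (- dual_exponent))"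
  proof -
    have "L powr (- z) = (M powr (- z))\<^sup>2" "M powr (- z) = exp (z * t)" for z
      by (simp_all add: L_def M_def powr_def power2_eq_square exp_add[symmetric])
    then show ?thesis by (simp add: c_def power2_eq_square algebra_simps)
  qed
  then have "weighted_moment \<epsilon> L - c * weighted_moment \<epsilon> M = 0"
    unfolding weighted_moment_eq[OF pos(1)] weighted_moment_eq[OF pos(2)] by (simp add: e)
  then show ?thesis
  proof (intro sign_inf_le_profile_comb[of L M _ c])
    fix x assume x: "rnorm d x \<ge> sqrt (moment_exponent / pi) + 4"
    define u where "u = pi * (rnorm d x)\<^sup>2"
    have u: "u \<ge> (sqrt moment_exponent + 7)\<^sup>2" unfolding u_def by (rule radius_bound) (use a x in auto)
    have "exp (- exp (- 2 * t) * u) - exp (2 * t * D) * exp (- u / exp (- 2 * t))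
        - c * (exp (- exp (- t) * u) - M powr (- D) * exp (- u / M)) > 0"
      unfolding t_def by (rule antisymmetric_profile_pos[OF a u]) (use c pos in \<open>auto simp: t_def\<close>)
    moreover have "L powr (- D) = exp (2 * t * D)" by (simp add: L_def powr_def mult_ac)
    ultimately show "profile_comb \<epsilon> 1 L c M x > 0"
      unfolding profile_comb_def profile_radial e u_def[symmetric] D_def[symmetric]
      by (simp add: L_def M_def)
  qed (use pos a in \<open>auto intro: add_nonneg_pos\<close>)
qed

lemma sign_inf_bound:
  assumes "d \<ge> 1"
  shows "sign_inf s r P d \<le> sqrt (max (real d + real l + \<gamma>) (real l - \<gamma>) / (2 * pi)) + 4"
proof -
  have eq: "max (real d + real l + \<gamma>) (real l - \<gamma>) / (2 * pi) = max moment_exponent dual_exponent / pi"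
    by (simp add: moment_exponent_def dual_exponent_def max_def field_simps)
  have a: "max moment_exponent dual_exponent \<ge> 0" using \<gamma> by (simp add: moment_exponent_def le_max_iff_disj)
  consider "\<epsilon> = 1" | "\<epsilon> = - 1" "\<gamma> \<le> - real d / 2" | "\<epsilon> = - 1" "\<gamma> > - real d / 2"
    using \<epsilon> by force
  then show ?thesis unfolding eq
  proof cases
    case 1
    then show "sign_inf s r P d \<le> sqrt (max moment_exponent dual_exponent / pi) + 4" by (rule sign_inf_le_symmetric)
  next
    case 2
    then show "sign_inf s r P d \<le> sqrt (max moment_exponent dual_exponent / pi) + 4"
      using sign_inf_eq_0[OF 2 assms] a by (simp add: add_nonneg_pos order.strict_implies_order)
  next
    case 3
    then have "max moment_exponent dual_exponent = moment_exponent" by (auto simp: moment_exponent_def dual_exponent_def)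
    then show "sign_inf s r P d \<le> sqrt (max moment_exponent dual_exponent / pi) + 4"
      using sign_inf_le_antisymmetric[OF 3] by simp
  qed
qed

end

section \<open>Parity and the main result\<close>

text \<open>
  The simplest harmonic polynomials of degree 0 and 1, needed when the parity of \<open>P\<close> differs from
  that of its harmonic factor.
\<close>
lemma coordinate_power_harmonic:
  assumes "d \<ge> 1" "r \<le> 1"
  shows "homogeneous_polynomial d r (\<lambda>x. x 0 ^ r)" "harmonic d (\<lambda>x. x 0 ^ r)"
proof -
  define e :: "nat \<Rightarrow> nat" where "e i = (if i = 0 then r else 0)" for i
  have H: "x 0 ^ r = poly_fun d {e} (\<lambda>\<alpha>. \<alpha>) (\<lambda>_. 1) x" for x
    using assms(1) by (simp add: poly_fun_def e_def prod.remove[of "{..<d}" 0])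
  have "(\<Sum>i<d. e i) = r" using assms(1) by (simp add: e_def)
  then show "homogeneous_polynomial d r (\<lambda>x. x 0 ^ r)"
    unfolding homogeneous_polynomial_def
    by (intro exI[of _ "{e}"] exI[of _ "\<lambda>_. 1"]) (use H in \<open>auto simp: poly_fun_def\<close>)
  have "e i * (e i - 1) = 0" for i
    using assms(2) by (cases r) (auto simp: e_def)
  then have 0: "poly_fun d {e} (\<lambda>j. j(i := j i - 2)) (\<lambda>j. 1 * real (j i * (j i - 1))) x = 0" for i x
    by (simp only: poly_fun_def sum.insert finite.emptyI sum.empty empty_iff not_False_eq_True of_nat_0)
  have "partial_deriv i (partial_deriv i (\<lambda>x. x 0 ^ r)) x = 0" if "x \<in> Rn d" "i < d" for i x
    unfolding partial_deriv_twice[OF H that] by (rule 0)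
  then show "harmonic d (\<lambda>x. x 0 ^ r)"
    by (simp add: harmonic_def)
qed

lemma minus_i_power_times_i_power: "(- \<i>) ^ l * \<i> ^ l = 1"
  by (simp add: power_mult_distrib[symmetric])

lemma polynomial_weight_eventually_nonneg:
  assumes Q: "eventually_nonneg d Q" and P: "\<And>x. x \<in> Rn d \<Longrightarrow> P x = H x * Q x"
  shows "\<exists>R. \<forall>x\<in>Rn d. rnorm d x \<ge> R \<longrightarrow> P x * H x \<ge> (0 :: real)"
proof -
  obtain R where "\<And>x. x \<in> Rn d \<Longrightarrow> rnorm d x \<ge> R \<Longrightarrow> Q x \<ge> 0"
    using Q unfolding eventually_nonneg_def by blast
  then have "P x * H x \<ge> 0" if "x \<in> Rn d" "rnorm d x \<ge> R" for x
    using that mult_nonneg_nonneg[of "H x * H x" "Q x"] by (simp add: P mult_ac)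
  then show ?thesis by blast
qed

text \<open>
  \<open>P H\<close> is odd and, far out, non-negative at both \<open>x\<close> and \<open>- x\<close>.
\<close>
lemma P_eventually_zero_if_parities_differ:
  assumes H: "\<And>x. x \<in> Rn d \<Longrightarrow> H (rscale d (- 1) x) = (- 1) ^ l * H x"
    and P': "\<And>x. x \<in> Rn d \<Longrightarrow> P (rscale d (- 1) x) = (- 1) ^ r * P x"
    and PH: "\<And>x. x \<in> Rn d \<Longrightarrow> rnorm d x \<ge> R \<Longrightarrow> P x * H x \<ge> (0 :: real)"
    and P: "\<And>x. x \<in> Rn d \<Longrightarrow> P x = H x * Q x"
    and odd: "odd (l + r)" and x: "x \<in> Rn d" "rnorm d x \<ge> R"
  shows "P x = 0"
proof -
  have "P (rscale d (- 1) x) * H (rscale d (- 1) x) \<ge> 0"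
    using x by (intro PH) (auto simp: rnorm_minus)
  then have "(- 1) ^ (l + r) * (P x * H x) \<ge> 0"
    using x by (simp add: H P' power_add mult_ac)
  then have "P x * H x \<le> 0" using odd by simp
  with PH[OF x] have "P x * H x = 0" by simp
  then show ?thesis using P[OF x(1)] by auto
qed

text \<open>
  Equal parities make \<open>s i\<^sup>l\<^sup>+\<^sup>r\<close> a sign \<open>\<epsilon>\<close>, and the polynomial \<open>H\<close> itself gives the test functions.
  If the parities differ, \<open>P\<close> vanishes far out, and by homogeneity it would then vanish at every
  point off the origin.
\<close>
theorem sign_uncertainty_polynomial_weight:
  fixes s \<gamma> :: real
  assumes d: "d \<ge> 1" and s: "s \<in> {1, - 1}" and r: "r \<in> {0, 1 :: nat}"
    and Pm: "P \<in> borel_measurable (leb d)" and Pnz: "\<exists>x\<in>Rn d - {rzero d}. P x \<noteq> 0"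
    and par: "\<And>x. x \<in> Rn d \<Longrightarrow> P (rscale d (- 1) x) = (- 1) ^ r * P x"
    and Pint: "\<And>a. a > 0 \<Longrightarrow> integrable (leb d) (\<lambda>x. P x * exp (- a * pi * (rnorm d x)\<^sup>2))"
    and hom: "homogeneous_polynomial d l H" and harm: "harmonic d H"
    and Q: "eventually_nonneg d Q" and P: "\<And>x. x \<in> Rn d \<Longrightarrow> P x = H x * Q x"
  shows "sign_class s r P d \<noteq> {}"
    and "\<lbrakk>\<gamma> > - real d; \<And>\<delta> x. \<delta> > 0 \<Longrightarrow> x \<in> Rn d \<Longrightarrow> P (rscale d \<delta> x) = \<delta> powr \<gamma> * P x\<rbrakk> \<Longrightarrow>
      sign_inf s r P d \<le> sqrt (max (real d + real l + \<gamma>) (real l - \<gamma>) / (2 * pi)) + 4 \<and>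
      (complex_of_real s * \<i> ^ (l + r) = - 1 \<and> \<gamma> \<le> - real d / 2 \<longrightarrow> sign_inf s r P d = 0)"
proof -
  interpret W: weighted_harmonic d l H P
    by unfold_locales (use hom harm Pm Pint in auto)
  obtain R where R: "\<And>x. x \<in> Rn d \<Longrightarrow> rnorm d x \<ge> R \<Longrightarrow> P x * H x \<ge> 0"
    using polynomial_weight_eventually_nonneg[OF Q P] by blast
  obtain x0 where x0: "x0 \<in> Rn d" "rnorm d x0 > 0" "P x0 \<noteq> 0"
    using Pnz rnorm_pos by blast
  have Hx0: "H x0 \<noteq> 0" using x0 P by auto
  have "sign_class s r P d \<noteq> {} \<and>
    (\<gamma> > - real d \<and> (\<forall>\<delta>>0. \<forall>x\<in>Rn d. P (rscale d \<delta> x) = \<delta> powr \<gamma> * P x) \<longrightarrow>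
      sign_inf s r P d \<le> sqrt (max (real d + real l + \<gamma>) (real l - \<gamma>) / (2 * pi)) + 4 \<and>
      (complex_of_real s * \<i> ^ (l + r) = - 1 \<and> \<gamma> \<le> - real d / 2 \<longrightarrow> sign_inf s r P d = 0))"
  proof (cases "even (l + r)")
    case True
    then obtain k where k: "l + r = 2 * k" by blast
    define \<epsilon> where "\<epsilon> = s * (- 1) ^ k"
    have e: "\<epsilon> \<in> {1, - 1}" using s by (cases "even k") (auto simp: \<epsilon>_def)
    have e': "complex_of_real \<epsilon> = of_real s * \<i> ^ (l + r)" by (simp add: \<epsilon>_def k power_mult)
    have "(- \<i>) ^ l * of_real \<epsilon> = ((- \<i>) ^ l * \<i> ^ l) * (of_real s * \<i> ^ r)"
      unfolding e' power_add by (simp only: mult_ac)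
    then have eig: "(- \<i>) ^ l * of_real \<epsilon> = of_real s * \<i> ^ r"
      unfolding minus_i_power_times_i_power by simp
    interpret N: nonzero_weighted_harmonic d l H P \<epsilon> s r
      by unfold_locales (use x0 Hx0 e eig in auto)
    have "sign_class s r P d \<noteq> {}" by (rule N.sign_class_nonempty) (rule R)
    moreover have "sign_inf s r P d \<le> sqrt (max (real d + real l + \<gamma>) (real l - \<gamma>) / (2 * pi)) + 4 \<and>
      (complex_of_real s * \<i> ^ (l + r) = - 1 \<and> \<gamma> \<le> - real d / 2 \<longrightarrow> sign_inf s r P d = 0)"
      if g: "\<gamma> > - real d" "\<forall>\<delta>>0. \<forall>x\<in>Rn d. P (rscale d \<delta> x) = \<delta> powr \<gamma> * P x"
    proof -
      interpret homogeneous_weight d l H P \<epsilon> s r \<gamma>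
        by unfold_locales (use g R in auto)
      have "\<epsilon> = - 1" if "complex_of_real s * \<i> ^ (l + r) = - 1"
        using e' that by (metis of_real_1 of_real_eq_iff of_real_minus)
      then show ?thesis using sign_inf_bound[OF d] sign_inf_eq_0 d by blast
    qed
    ultimately show ?thesis by blast
  next
    case False
    have far: "P x = 0" if "x \<in> Rn d" "rnorm d x \<ge> R" for x
      by (rule P_eventually_zero_if_parities_differ[of d H l P r R Q, OF W.H_rscale par R P False that])
    define H0 :: "(nat \<Rightarrow> real) \<Rightarrow> real" where "H0 x = x 0 ^ r" for x
    define \<epsilon> where "\<epsilon> = s * (- 1) ^ r"
    define x1 where "x1 = (\<lambda>i\<in>{..<d}. 1 :: real)"
    have "\<bar>x1 0\<bar> \<le> rnorm d x1" by (rule abs_coordinate_le_rnorm) (use d in simp)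
    moreover have "x1 0 = 1" using d by (simp add: x1_def)
    ultimately have x1: "x1 \<in> Rn d" "rnorm d x1 > 0" "H0 x1 \<noteq> 0"
      by (simp_all add: H0_def) (simp add: x1_def Rn_def)
    interpret N: nonzero_weighted_harmonic d r H0 P \<epsilon> s r
    proof unfold_locales
      show "homogeneous_polynomial d r H0" "harmonic d H0"
        using coordinate_power_harmonic[OF d, of r] r unfolding H0_def[abs_def] by auto
      show "\<epsilon> \<in> {1, - 1}" "(- \<i>) ^ r * complex_of_real \<epsilon> = complex_of_real s * \<i> ^ r"
        using s r by (auto simp: \<epsilon>_def)
    qed (use x1 Pm Pint in auto)
    have "sign_class s r P d \<noteq> {}"
      by (rule N.sign_class_nonempty_if_vanishing) (rule far)
    moreover have False if "\<forall>\<delta>>0. \<forall>x\<in>Rn d. P (rscale d \<delta> x) = \<delta> powr \<gamma> * P x"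
    proof -
      define \<delta> where "\<delta> = max 1 (R / rnorm d x0)"
      have \<delta>: "\<delta> > 0" by (simp add: \<delta>_def)
      have "\<delta> * rnorm d x0 \<ge> R / rnorm d x0 * rnorm d x0"
        unfolding \<delta>_def using x0 by (intro mult_right_mono) auto
      then have "P (rscale d \<delta> x0) = 0"
        using x0 \<delta> by (intro far) (auto simp: rnorm_rscale)
      then show False using that x0 \<delta> by auto
    qed
    ultimately show ?thesis by blast
  qed
  then show "sign_class s r P d \<noteq> {}"
    and "\<lbrakk>\<gamma> > - real d; \<And>\<delta> x. \<delta> > 0 \<Longrightarrow> x \<in> Rn d \<Longrightarrow> P (rscale d \<delta> x) = \<delta> powr \<gamma> * P x\<rbrakk> \<Longrightarrow>
      sign_inf s r P d \<le> sqrt (max (real d + real l + \<gamma>) (real l - \<gamma>) / (2 * pi)) + 4 \<and>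
      (complex_of_real s * \<i> ^ (l + r) = - 1 \<and> \<gamma> \<le> - real d / 2 \<longrightarrow> sign_inf s r P d = 0)"
    by blast+
qed

theorem theorem1:
  shows "\<exists>C::real. \<forall>(d::nat) (s::real) (r::nat) (l::nat)
      (P :: (nat \<Rightarrow> real) \<Rightarrow> real) (H :: (nat \<Rightarrow> real) \<Rightarrow> real) (Q :: (nat \<Rightarrow> real) \<Rightarrow> real).
    d \<ge> 1 \<and> s \<in> {1, -1} \<and> r \<in> {0, 1} \<and>
    P \<in> borel_measurable (leb d) \<and>
    (\<exists>x\<in>Rn d - {rzero d}. P x \<noteq> 0) \<and>
    locally_integrable d P \<and>
    (\<forall>x\<in>Rn d. P (rscale d (-1) x) = (-1) ^ r * P x) \<and>
    (\<forall>a>0. integrable (leb d) (\<lambda>x. P x * exp (- a * pi * (rnorm d x)\<^sup>2))) \<and>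
    homogeneous_polynomial d l H \<and> harmonic d H \<and>
    eventually_nonneg d Q \<and>
    (\<forall>x\<in>Rn d. P x = H x * Q x)
    \<longrightarrow>
    sign_class s r P d \<noteq> {} \<and>
    (\<forall>\<gamma>::real. \<gamma> > - real d \<and>
        (\<forall>\<delta>>0. \<forall>x\<in>Rn d. P (rscale d \<delta> x) = \<delta> powr \<gamma> * P x) \<longrightarrow>
      sign_inf s r P d \<le> sqrt (max (real d + real l + \<gamma>) (real l - \<gamma>) / (2 * pi)) + C \<and>
      (complex_of_real s * \<i> ^ (l + r) = -1 \<and> \<gamma> \<le> - real d / 2 \<longrightarrow> sign_inf s r P d = 0))"
proof (intro exI[of _ 4] allI impI, elim conjE)
  fix d :: nat and s :: real and r l :: nat and P H Q :: "(nat \<Rightarrow> real) \<Rightarrow> real"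
  assume *: "d \<ge> 1" "s \<in> {1, - 1}" "r \<in> {0, 1}" "P \<in> borel_measurable (leb d)"
    "\<exists>x\<in>Rn d - {rzero d}. P x \<noteq> 0"
    "\<forall>x\<in>Rn d. P (rscale d (- 1) x) = (- 1) ^ r * P x"
    "\<forall>a>0. integrable (leb d) (\<lambda>x. P x * exp (- a * pi * (rnorm d x)\<^sup>2))"
    "homogeneous_polynomial d l H" "harmonic d H" "eventually_nonneg d Q" "\<forall>x\<in>Rn d. P x = H x * Q x"
  note main = sign_uncertainty_polynomial_weight[OF *(1-5) *(6)[rule_format] *(7)[rule_format] *(8-10) *(11)[rule_format]]
  show "sign_class s r P d \<noteq> {} \<and>
    (\<forall>\<gamma>::real. \<gamma> > - real d \<and>
        (\<forall>\<delta>>0. \<forall>x\<in>Rn d. P (rscale d \<delta> x) = \<delta> powr \<gamma> * P x) \<longrightarrow>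
      sign_inf s r P d \<le> sqrt (max (real d + real l + \<gamma>) (real l - \<gamma>) / (2 * pi)) + 4 \<and>
      (complex_of_real s * \<i> ^ (l + r) = -1 \<and> \<gamma> \<le> - real d / 2 \<longrightarrow> sign_inf s r P d = 0))"
    using main by blast
qed

end
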